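(* Let $d\ge l\ge 3$. Every $d$-uniform hypergraph $H$ on $n$ vertices that is piecewise linearly embeddable into $\mathbb{R}^{2d-l}$ (in particular every $H\in\mathcal{E}_{2d-l,d}$ on $n$ vertices) satisfies \[\chi^{\mathsf{w}}(H)\le\left\lceil (ed)^{\frac{1}{d-1}}\, n^{\,1-\frac{3^{l-1-d}}{d-1}}\right\rceil .\] In particular $\chi^{\mathsf{w}}_{2d-l,d}(n)=\mathcal{O}\bigl(n^{1-3^{l-1-d}/(d-1)}\bigr)$.
   Context: A $k$-uniform hypergraph $H=(V,E)$ consists of a finite set $V$ and $E\subseteq\binom{V}{k}$. A (linear) embedding of $H$ into $\mathbb{R}^d$ is a map $\phi:V(H)\to\mathbb{R}^d$ with $\dim\operatorname{aff}\phi(e)=k-1$ for every edge $e$ and $\operatorname{conv}\phi(e_1)\cap\operatorname{conv}\phi(e_2)=\operatorname{conv}\phi(e_1\cap e_2)$ for all edges $e_1,e_2$; $\mathcal{E}_{d,k}$ is the set of $k$-uniform hypergraphs admitting one. Every $k$-uniform hypergraph admits a linear embedding $\phi$ into $\mathbb{R}^{2k-1}$; with $\phi(H)=\bigcup_{e}\operatorname{conv}\phi(e)$, a piecewise linear embedding of $H$ into $\mathbb{R}^d$ is a map $\psi:\phi(H)\to\mathbb{R}^d$ that is a homeomorphism onto its image and is affine on each simplex of some subdivision of $\phi(H)$. A weak $c$-coloring of $H$ is a map $\kappa:V(H)\to\{1,\dots,c\}$ with $|\kappa(e)|>1$ for every edge $e$; $\chi^{\mathsf{w}}(H)$ is the least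 such $c$. $\chi^{\mathsf{w}}_{d,k}(n)=\max\{\chi^{\mathsf{w}}(H): H\in\mathcal{E}_{d,k},\ |V(H)|=n\}$. Here $e$ denotes Euler's number. *)

theory Defs
  imports "HOL-Analysis.Analysis"
begin

definition uniform_hypergraph :: "nat \<Rightarrow> 'v set \<Rightarrow> 'v set set \<Rightarrow> bool" where
  "uniform_hypergraph k V E \<longleftrightarrow> finite V \<and> (\<forall>e\<in>E. e \<subseteq> V \<and> card e = k)"

definition lin_embedding :: "nat \<Rightarrow> 'v set \<Rightarrow> 'v set set \<Rightarrow> ('v \<Rightarrow> 'a::euclidean_space) \<Rightarrow> bool" where
  "lin_embedding k V E \<phi> \<longleftrightarrow>
     (\<forall>e\<in>E. aff_dim (\<phi> ` e) = int k - 1) \<and>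
     (\<forall>e1\<in>E. \<forall>e2\<in>E. convex hull (\<phi> ` e1) \<inter> convex hull (\<phi> ` e2) = convex hull (\<phi> ` (e1 \<inter> e2)))"

definition hg_image :: "'v set set \<Rightarrow> ('v \<Rightarrow> 'a::euclidean_space) \<Rightarrow> 'a set" where
  "hg_image E \<phi> = (\<Union>e\<in>E. convex hull (\<phi> ` e))"

definition pl_embedding :: "'v set set \<Rightarrow> ('v \<Rightarrow> 'b::euclidean_space) \<Rightarrow> ('b \<Rightarrow> 'a::euclidean_space) \<Rightarrow> bool" where
  "pl_embedding E \<phi> \<psi> \<longleftrightarrow>
     (\<exists>g. homeomorphism (hg_image E \<phi>) (\<psi> ` hg_image E \<phi>) \<psi> g) \<and>
     (\<exists>\<T>. triangulation \<T> \<and> \<Union>\<T> = hg_image E \<phi> \<and>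
          (\<forall>S\<in>\<T>. \<exists>e\<in>E. S \<subseteq> convex hull (\<phi> ` e)) \<and>
          (\<forall>S\<in>\<T>. \<exists>A c. linear A \<and> (\<forall>x\<in>S. \<psi> x = A x + c)))"

definition weak_coloring :: "'v set \<Rightarrow> 'v set set \<Rightarrow> nat \<Rightarrow> ('v \<Rightarrow> nat) \<Rightarrow> bool" where
  "weak_coloring V E c \<kappa> \<longleftrightarrow> (\<forall>v\<in>V. \<kappa> v \<in> {1..c}) \<and> (\<forall>e\<in>E. card (\<kappa> ` e) > 1)"

definition weak_chi :: "'v set \<Rightarrow> 'v set set \<Rightarrow> nat" where
  "weak_chi V E = (LEAST c. \<exists>\<kappa>. weak_coloring V E c \<kappa>)"

end

(* Let m = d - l + 2. The deleted join of the complete partite hypergraph with m parts of size 3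
   and l - 2 parts of size 1 is a sphere of dimension 2d - l + 1 (a join of m hexagons and l - 2
   copies of S^0), so by the Borsuk-Ulam theorem every continuous map of this hypergraph into
   R^(2d-l) identifies two points in disjoint faces; an embedded H therefore does not contain it.
   Hence the link of a vertex contains no complete partite hypergraph with m parts of size 3 and
   l - 3 parts of size 1, and Erdos' argument bounds every degree by n^(d-1-3^(l-1-d)). A counting
   argument of Rosenfeld type, in place of the Local Lemma, turns the degree bound into a weak
   coloring. Borsuk-Ulam is derived from Tucker's lemma, which follows by counting flags of cubical
   cells with alternating labels modulo 2. *)
theory Submission
  imports Defs "HOL-Combinatorics.Multiset_Permutations"
begin

section \<open>Alternating label sequences\<close>

text \<open>Why parts of size 3: the deleted join of three points is a circle, so such a part adds
  two dimensions to the ambient space of the sphere, while a part of size 1 adds one. The d = m + (l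
  - 2) parts must add up to 2m + (l - 2) = (2d - l) + 2, which fixes m. In Erdos' bound a single
  part of size 3 saves 1 in the exponent, each further one divides the saving by 3, and parts of
  size 1 cost nothing; this gives 3^(1-m) = 3^(l-1-d). The coloring argument needs a bound on
  degrees rather than on the number of edges; passing to the link spends one part of size 1, the
  vertex itself, and this is where l >= 3 enters. A degree bound D costs about (e d D)^(1/(d-1))
  colors, hence the remaining constants. The deleted join is never built as a complex: continuous
  weights on a Euclidean space, whose supports at x and -x are disjoint faces, take its place, and
  Borsuk-Ulam is used as the existence of a nonzero zero of an odd map.\<close>

fun alternating :: "bool \<Rightarrow> nat list \<Rightarrow> bool" where
  "alternating s [] = True"
| "alternating s (x # xs) = (even x = s \<and> alternating (\<not> s) xs)"

fun alternating_deletions :: "bool \<Rightarrow> nat list \<Rightarrow> nat" where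
  "alternating_deletions s [] = 0"
| "alternating_deletions s (x # xs) =
    of_bool (alternating s xs) + (if even x = s then alternating_deletions (\<not> s) xs else 0)"

text \<open>An alternating list has exactly one deletion that counts: its last entry if it starts
  with the parity \<open>s\<close>, its first entry otherwise. A list that is not alternating has
  two if it starts with \<open>s\<close> and a single repeated parity between neighbours is its only
  defect, and none otherwise. The empty list alternates in both senses, hence
  \<open>\<noteq>\<close> in place of a disjunction.\<close>

lemma odd_alternating_deletions:
  "odd (alternating_deletions s xs) \<longleftrightarrow> alternating s xs \<noteq> alternating (\<not> s) xs"
  by (induction xs arbitrary: s) auto

lemma alternating_exclusive: "xs \<noteq> [] \<Longrightarrow> alternating s xs \<Longrightarrow> \<not> alternating (\<not> s) xs"
  by (cases xs) auto

lemma alternating_sorted_distinct: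
  "sorted xs \<Longrightarrow> alternating s xs \<Longrightarrow> distinct xs"
proof (induction xs arbitrary: s)
  case (Cons x xs)
  have "x \<notin> set xs"
  proof
    assume "x \<in> set xs"
    with Cons.prems(1) obtain ys where "xs = x # ys"
      by (cases xs) auto
    with Cons.prems show False by auto
  qed
  with Cons show ?case by auto
qed simp

text \<open>Equal entries of a sorted list are adjacent, so removing the first copy yields the same
  list as removing any other; positions may be replaced by entries.\<close>

lemma alternating_deletions_sorted:
  "sorted xs \<Longrightarrow> alternating_deletions s xs = (\<Sum>x\<leftarrow>xs. of_bool (alternating s (remove1 x xs)))"
proof (induction xs arbitrary: s)
  case (Cons x xs)
  have r: "remove1 y (x # xs) = x # remove1 y xs" if "y \<in> set xs" for y
    using that Cons.prems by (cases xs) auto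
  have "(\<Sum>y\<leftarrow>xs. of_bool (alternating s (remove1 y (x # xs)))) =
        (\<Sum>y\<leftarrow>xs. of_bool (even x = s) * of_bool (alternating (\<not> s) (remove1 y xs)) :: nat)"
    by (intro arg_cong[where f = sum_list] map_cong refl) (auto simp: r simp del: remove1.simps)
  also have "\<dots> = of_bool (even x = s) * alternating_deletions (\<not> s) xs"
    using Cons by (simp add: sum_list_const_mult)
  finally have "(\<Sum>y\<leftarrow>xs. of_bool (alternating s (remove1 y (x # xs)))) =
    of_bool (even x = s) * alternating_deletions (\<not> s) xs" .
  then show ?case by (simp del: remove1.simps add: remove1.simps(2)[of x x])
qed simp

text \<open>With signs as parities these are the alternating simplices of Ky Fan's lemma, the labels
  being ordered by absolute value.\<close>

definition alternating_on :: "bool \<Rightarrow> ('i \<Rightarrow> nat) \<Rightarrow> 'i set \<Rightarrow> bool" where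
  "alternating_on s lab I = alternating s (sorted_list_of_multiset (image_mset lab (mset_set I)))"

text \<open>The local step of Fan's parity argument: summed over simplices, it trades alternating
  simplices for alternating facets modulo 2.\<close>

lemma odd_alternating_facets:
  assumes "finite I" "I \<noteq> {}"
  shows "odd (card {i\<in>I. alternating_on s lab (I - {i})}) \<longleftrightarrow>
         alternating_on s lab I \<or> alternating_on (\<not> s) lab I"
proof -
  define M where "M = image_mset lab (mset_set I)"
  define xs where "xs = sorted_list_of_multiset M"
  have M: "mset xs = M" by (simp add: xs_def)
  have xs: "sorted xs" by (simp add: xs_def)
  have "M \<noteq> {#}" using assms by (simp add: M_def mset_set_empty_iff)
  then have ne: "xs \<noteq> []" using M by auto
  have facet: "sorted_list_of_multiset (image_mset lab (mset_set (I - {i}))) = remove1 (lab i) xs"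
    if "i \<in> I" for i
  proof -
    have "image_mset lab (mset_set (I - {i})) = M - {#lab i#}"
      using that assms(1) by (simp add: M_def mset_set_Diff image_mset_Diff)
    also have "\<dots> = mset (remove1 (lab i) xs)" using M by simp
    finally show ?thesis
      using sorted_remove1[OF xs, of "lab i"] by (simp add: sorted_sort_id del: mset_remove1)
  qed
  have "card {i\<in>I. alternating_on s lab (I - {i})} = (\<Sum>i\<in>I. of_bool (alternating s (remove1 (lab i) xs)))"
    using assms(1) by (simp add: alternating_on_def facet Int_def cong: conj_cong)
  also have "\<dots> = (\<Sum>x\<in>#M. of_bool (alternating s (remove1 x xs)))"
    by (simp add: M_def sum_unfold_sum_mset multiset.map_comp comp_def)
  also have "\<dots> = (\<Sum>x\<leftarrow>xs. of_bool (alternating s (remove1 x xs)))"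
    by (metis M mset_map sum_mset_sum_list)
  also have "\<dots> = alternating_deletions s xs" using alternating_deletions_sorted[OF xs] by simp
  finally show ?thesis
    using odd_alternating_deletions[of s xs] alternating_exclusive[OF ne, of s]
    by (auto simp: alternating_on_def xs_def M_def)
qed

lemma alternating_on_exclusive:
  assumes "finite I" "I \<noteq> {}" "alternating_on s lab I"
  shows "\<not> alternating_on (\<not> s) lab I"
proof -
  have "sorted_list_of_multiset (image_mset lab (mset_set I)) \<noteq> []"
    using assms(1,2) by (metis image_mset_is_empty_iff mset_set_empty_iff mset_sorted_list_of_multiset mset_zero_iff)
  then show ?thesis using assms(3) alternating_exclusive unfolding alternating_on_def by blast
qed

lemma alternating_on_inj:
  assumes "finite I" "alternating_on s lab I"
  shows "inj_on lab I"
proof -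
  let ?M = "image_mset lab (mset_set I)"
  have "distinct (sorted_list_of_multiset ?M)"
    using alternating_sorted_distinct assms(2) sorted_sorted_list_of_multiset
    unfolding alternating_on_def by blast
  then have "size ?M = card (set_mset ?M)"
    by (metis distinct_card mset_sorted_list_of_multiset set_mset_mset size_mset)
  then show ?thesis using assms(1) by (simp add: eq_card_imp_inj_on)
qed

text \<open>The signed labels \<open>+i\<close> and \<open>-i\<close> are encoded as \<open>2i\<close> and \<open>2i + 1\<close>, so that signs are parities and
  \<open>flip\<close> is negation.\<close>

definition flip :: "nat \<Rightarrow> nat" where
  "flip x = (if even x then x + 1 else x - 1)"

lemma flip_flip [simp]: "flip (flip x) = x"
  by (auto simp: flip_def)

lemma even_flip [simp]: "even (flip x) \<longleftrightarrow> odd x"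
  by (auto simp: flip_def)

lemma alternating_flip: "alternating s (map flip xs) = alternating (\<not> s) xs"
  by (induction xs arbitrary: s) auto

text \<open>\<open>flip\<close> exchanges the two members of each block {2i, 2i + 1}, so it keeps
  the order between blocks and inverts it only within one.\<close>

lemma flip_mono:
  assumes "x \<le> y" "y \<noteq> flip x" shows "flip x \<le> flip y"
  using assms by (cases "x = y") (auto simp: flip_def elim!: evenE oddE split: if_splits)

text \<open>In the absence of complementary labels \<open>flip\<close> keeps the sorted order, so it
  only changes the parity of every entry of the sorted list.\<close>

lemma alternating_on_flip:
  assumes "finite I" "\<And>i j. i \<in> I \<Longrightarrow> j \<in> I \<Longrightarrow> lab j \<noteq> flip (lab i)"
  shows "alternating_on s (\<lambda>i. flip (lab i)) I = alternating_on (\<not> s) lab I"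
proof -
  let ?M = "image_mset lab (mset_set I)"
  let ?xs = "sorted_list_of_multiset ?M"
  have "sorted_wrt (\<lambda>x y. flip x \<le> flip y) ?xs"
  proof (rule sorted_wrt_mono_rel[OF _ sorted_sorted_list_of_multiset])
    fix x y assume "x \<in> set ?xs" "y \<in> set ?xs" "x \<le> y"
    moreover from this obtain i j where "i \<in> I" "j \<in> I" "x = lab i" "y = lab j"
      using assms(1) by auto
    ultimately show "flip x \<le> flip y" using assms(2) flip_mono by blast
  qed
  then have "sorted (map flip ?xs)" by (simp add: sorted_wrt_map)
  moreover have "mset (map flip ?xs) = image_mset (\<lambda>i. flip (lab i)) (mset_set I)"
    by (simp add: multiset.map_comp comp_def)
  ultimately have "sorted_list_of_multiset (image_mset (\<lambda>i. flip (lab i)) (mset_set I)) = map flip ?xs"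
    by (metis sorted_list_of_multiset_mset sorted_sort_id)
  then show ?thesis by (simp add: alternating_on_def alternating_flip)
qed

lemma even_card_involution:
  assumes "finite A" "\<And>x. x \<in> A \<Longrightarrow> h x \<in> A" "\<And>x. x \<in> A \<Longrightarrow> h (h x) = x" "\<And>x. x \<in> A \<Longrightarrow> h x \<noteq> x"
  shows "even (card A)"
proof -
  have "card A = (\<Sum>P\<in>(\<lambda>x. {x, h x}) ` A. card {x\<in>A. {x, h x} = P})"
    using sum.image_gen[OF assms(1), of "\<lambda>_. 1::nat" "\<lambda>x. {x, h x}"] by simp
  moreover have "even (card {y\<in>A. {y, h y} = P})" if P: "P \<in> (\<lambda>x. {x, h x}) ` A" for P
  proof -
    obtain x where x: "x \<in> A" "P = {x, h x}" using P by auto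
    have "{y\<in>A. {y, h y} = P} = {x, h x}" using x assms(2,3) by (auto simp: doubleton_eq_iff)
    then show ?thesis using assms(4)[OF x(1)] by simp
  qed
  ultimately show ?thesis by (simp add: dvd_sum)
qed

section \<open>Cells of the boundary of a cube\<close>

text \<open>Coordinates are doubled: an even entry \<open>2x\<close> is the grid point \<open>x\<close> and an odd entry \<open>2x + 1\<close> the open
  unit interval above \<open>x\<close>. Thus \<open>cells p k\<close> is the cubical decomposition of the boundary of
  \<open>[-p, p]\<^sup>k\<^sup>+\<^sup>1\<close>, and the sphere of dimension \<open>k - 1\<close> sits in it as the equator where coordinate \<open>k\<close> vanishes.\<close>

type_synonym cell = "nat \<Rightarrow> int"

definition face_le :: "cell \<Rightarrow> cell \<Rightarrow> bool" where
  "face_le c c' \<longleftrightarrow> (\<forall>i. c i = c' i \<or> odd (c' i) \<and> \<bar>c' i - c i\<bar> = 1)"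

definition cells :: "int \<Rightarrow> nat \<Rightarrow> cell set" where
  "cells p k = {c. (\<forall>i>k. c i = 0) \<and> (\<forall>i. \<bar>c i\<bar> \<le> 2 * p) \<and> (\<exists>i. \<bar>c i\<bar> = 2 * p)}"

definition cell_dim :: "cell \<Rightarrow> nat" where
  "cell_dim c = card {i. odd (c i)}"

lemma finite_cells: "finite (cells p k)"
proof -
  let ?F = "{c. \<forall>i. (i \<in> {..k} \<longrightarrow> c i \<in> {-2*p..2*p}) \<and> (i \<notin> {..k} \<longrightarrow> c i = 0)}"
  have F: "finite ?F" by (rule finite_set_of_finite_funs) simp_all
  have "c \<in> ?F" if "c \<in> cells p k" for c
  proof -
    have "\<bar>c i\<bar> \<le> 2 * p" "i > k \<Longrightarrow> c i = 0" for i using that by (simp_all add: cells_def)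
    then have "c i \<in> {-2*p..2*p}" "i \<notin> {..k} \<Longrightarrow> c i = 0" for i
      using abs_le_D1[of "c i" "2 * p"] abs_le_D2[of "c i" "2 * p"] by simp_all
    then show ?thesis by simp
  qed
  then have "cells p k \<subseteq> ?F" by (rule subsetI)
  then show ?thesis using F by (rule finite_subset)
qed

lemma cells_mono: "k \<le> k' \<Longrightarrow> cells p k \<subseteq> cells p k'"
  by (auto simp: cells_def)

lemma cells_support:
  assumes "c \<in> cells p k"
  shows "{i. odd (c i)} \<subseteq> {..k}"
proof
  fix i assume "i \<in> {i. odd (c i)}"
  then have "c i \<noteq> 0" by (metis even_zero mem_Collect_eq)
  then show "i \<in> {..k}" using assms by (cases "i \<le> k") (simp_all add: cells_def)
qed

lemma cells_finite_odd: "c \<in> cells p k \<Longrightarrow> finite {i. odd (c i)}"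
  by (rule finite_subset[OF cells_support finite_atMost])

lemma cell_dim_eq_sum:
  assumes "c \<in> cells p k"
  shows "cell_dim c = (\<Sum>i\<le>k. of_bool (odd (c i)))"
proof -
  have "{i. odd (c i)} = {i\<in>{..k}. odd (c i)}" using cells_support[OF assms] by blast
  then have "cell_dim c = card {i\<in>{..k}. odd (c i)}" by (simp only: cell_dim_def)
  also have "\<dots> = (\<Sum>i\<le>k. of_bool (odd (c i)))" by (simp add: Int_def)
  finally show ?thesis .
qed

lemma face_le_refl [simp]: "face_le c c" by (simp add: face_le_def)

lemma face_le_odd: "face_le c c' \<Longrightarrow> odd (c i) \<Longrightarrow> c i = c' i"
  unfolding face_le_def by (drule spec[of _ i]) presburger

lemma face_le_trans: "face_le c c' \<Longrightarrow> face_le c' c'' \<Longrightarrow> face_le c c''"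
  using face_le_odd[of c' c''] unfolding face_le_def by metis

lemma face_le_bound: "face_le c c' \<Longrightarrow> \<bar>c' i\<bar> \<le> 2 * p \<Longrightarrow> \<bar>c i\<bar> \<le> 2 * p"
  unfolding face_le_def by (drule spec[of _ i]) presburger

lemma cells_face:
  assumes "face_le c c'" "c' \<in> cells p k"
  shows "c \<in> cells p k"
proof -
  have "c i = 0" if "i > k" for i
  proof -
    have "c' i = 0" using assms(2) that by (auto simp: cells_def)
    then show ?thesis using assms(1) unfolding face_le_def by (metis even_zero)
  qed
  moreover have "\<bar>c i\<bar> \<le> 2 * p" for i
    using assms face_le_bound unfolding cells_def by blast
  \<comment> \<open>An extremal coordinate is even, hence not an interval that a face could
    collapse.\<close>
  moreover obtain i where i: "\<bar>c' i\<bar> = 2 * p" using assms(2) by (auto simp: cells_def)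
  then have "even (c' i)" by presburger
  then have "\<bar>c i\<bar> = 2 * p" using i assms(1) unfolding face_le_def by metis
  ultimately show ?thesis unfolding cells_def by blast
qed

text \<open>In each coordinate \<open>c'\<close> agrees with \<open>c\<close> or with
  \<open>c''\<close>, because an interval collapses at most once along the chain. So
  \<open>c + c'' - c'\<close> makes exactly those collapses first that \<open>c'\<close> leaves for
  later.\<close>

lemma middle_face:
  assumes "face_le c c'" "face_le c' c''"
  shows "face_le c (\<lambda>i. c i + c'' i - c' i)" "face_le (\<lambda>i. c i + c'' i - c' i) c''"
proof -
  have "(c i = c' i \<or> c' i = c'' i)" for i
    using assms(2) face_le_odd[OF assms(2)] assms(1) unfolding face_le_def by metis
  then have "c i + c'' i - c' i = c'' i \<and> c i = c' i \<or> c i + c'' i - c' i = c i \<and> c' i = c'' i" for i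
    by (metis add_diff_cancel_left' add_diff_cancel_right')
  then show "face_le c (\<lambda>i. c i + c'' i - c' i)" "face_le (\<lambda>i. c i + c'' i - c' i) c''"
    using assms unfolding face_le_def by metis+
qed

lemma middle_face_dim:
  assumes "face_le c c'" "face_le c' c''" "c'' \<in> cells p k"
  shows "cell_dim (\<lambda>i. c i + c'' i - c' i) + cell_dim c' = cell_dim c + cell_dim c''"
proof -
  have cl: "c' \<in> cells p k" "c \<in> cells p k" "(\<lambda>i. c i + c'' i - c' i) \<in> cells p k"
    using assms cells_face middle_face(2) by blast+
  have "(c i = c' i \<or> c' i = c'' i)" for i
    using assms(2) face_le_odd[OF assms(2)] assms(1) unfolding face_le_def by metis
  then have "of_bool (odd (c i + c'' i - c' i)) + of_bool (odd (c' i)) =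
     of_bool (odd (c i)) + (of_bool (odd (c'' i)) :: nat)" for i
    by (metis add.commute add_diff_cancel_left' add_diff_cancel_right')
  then show ?thesis
    unfolding cell_dim_eq_sum[OF cl(1)] cell_dim_eq_sum[OF cl(2)] cell_dim_eq_sum[OF cl(3)]
      cell_dim_eq_sum[OF assms(3)] sum.distrib[symmetric] by (intro sum.cong refl)
qed

lemma middle_face_neq:
  assumes "face_le c c'" "face_le c' c''" "c \<noteq> c'"
  shows "(\<lambda>i. c i + c'' i - c' i) \<noteq> c'"
proof
  assume *: "(\<lambda>i. c i + c'' i - c' i) = c'"
  have "(c i = c' i \<or> c' i = c'' i)" for i
    using assms(2) face_le_odd[OF assms(2)] assms(1) unfolding face_le_def by metis
  moreover have "c i + c'' i = 2 * c' i" for i using fun_cong[OF *, of i] by simp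
  ultimately have "c i = c' i" for i by (smt (verit))
  then show False using assms(3) by auto
qed

text \<open>Reflection in the centre of \<open>c'\<close> gives the opposite face; for an edge it is
  the other endpoint.\<close>

lemma reflect_face:
  assumes "face_le c c'"
  shows "face_le (\<lambda>i. c' i + c' i - c i) c'" "cell_dim (\<lambda>i. c' i + c' i - c i) = cell_dim c"
    "c \<noteq> c' \<Longrightarrow> (\<lambda>i. c' i + c' i - c i) \<noteq> c"
proof -
  show "face_le (\<lambda>i. c' i + c' i - c i) c'"
    using assms unfolding face_le_def by (smt (verit))
  show "cell_dim (\<lambda>i. c' i + c' i - c i) = cell_dim c"
    by (simp add: cell_dim_def)
  show "(\<lambda>i. c' i + c' i - c i) \<noteq> c" if "c \<noteq> c'"
  proof
    assume *: "(\<lambda>i. c' i + c' i - c i) = c"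
    have "c i = c' i" for i using fun_cong[OF *, of i] by simp
    then show False using that by auto
  qed
qed

lemma cell_dim_upd:
  assumes "c \<in> cells p k" "even (c a)" "odd v"
  shows "cell_dim (c(a := v)) = Suc (cell_dim c)"
proof -
  have "{i. odd ((c(a := v)) i)} = insert a {i. odd (c i)}" using assms(3) by auto
  then show ?thesis using assms(2) cells_finite_odd[OF assms(1)] by (simp add: cell_dim_def)
qed

lemma face_le_dim_Suc:
  assumes "face_le c t" "t \<in> cells p k" "cell_dim t = Suc (cell_dim c)"
  obtains a v where "a \<le> k" "even (c a)" "v = 1 \<or> v = -1" "t = c(a := c a + v)"
proof -
  have c: "c \<in> cells p k" using assms cells_face by blast
  have sub: "{i. odd (c i)} \<subseteq> {i. odd (t i)}" using face_le_odd[OF assms(1)] by auto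
  have "card ({i. odd (t i)} - {i. odd (c i)}) = 1"
    using assms(3) sub cells_finite_odd[OF c] by (simp add: card_Diff_subset cell_dim_def)
  then obtain a where a: "{i. odd (t i)} - {i. odd (c i)} = {a}" by (auto simp: card_1_singleton_iff)
  have eq: "t i = c i" if "i \<noteq> a" for i
    using that a assms(1) face_le_odd[OF assms(1)] unfolding face_le_def
    by (metis (mono_tags, lifting) DiffI empty_iff insert_iff mem_Collect_eq)
  have ta: "odd (t a)" "even (c a)" using a by auto
  then have v: "\<bar>t a - c a\<bar> = 1" using assms(1) unfolding face_le_def by metis
  show thesis
  proof (rule that[of a "t a - c a"])
    show "a \<le> k" using ta(1) cells_support[OF assms(2)] by auto
    show "t = c(a := c a + (t a - c a))" using eq by auto
  qed (use ta v in auto)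
qed

text \<open>For positive \<open>p\<close> a cell of dimension \<open>k\<close> never has coordinate
  \<open>k\<close> equal to 0, so the last condition selects the upper hemisphere.\<close>

definition tops :: "int \<Rightarrow> nat \<Rightarrow> cell \<Rightarrow> cell set" where
  "tops p k c = {t\<in>cells p k. cell_dim t = k \<and> face_le c t \<and> t k > 0}"

text \<open>Exactly two coordinates \<open>a\<close>, \<open>b\<close> of \<open>c\<close> are even,
  and \<open>b\<close> is extremal. If \<open>a\<close> is not extremal, \<open>b\<close> must stay
  fixed to remain on the boundary and \<open>a\<close> can move both ways. If both are extremal,
  either one can move inwards while the other keeps the cell on the boundary. On the equator
  \<open>a\<close> is the last coordinate, and only the upward move counts.\<close>

lemma card_tops:
  assumes p: "p > 0" and c: "c \<in> cells p (Suc j)" and d: "cell_dim c = j" and pos: "c (Suc j) \<ge> 0"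
  shows "card (tops p (Suc j) c) = (if c (Suc j) = 0 then 1 else 2)"
proof -
  let ?k = "Suc j"
  let ?E = "{i. i \<le> ?k \<and> even (c i)}"
  have bd: "\<bar>c i\<bar> \<le> 2 * p" for i using c by (auto simp: cells_def)
  have z: "c i = 0" if "i > ?k" for i using c that by (auto simp: cells_def)
  obtain b where b: "\<bar>c b\<bar> = 2 * p" using c by (auto simp: cells_def)
  have bk: "b \<le> ?k" using z[of b] b p by (cases "b \<le> ?k") auto
  have be: "even (c b)" using b by presburger
  have E: "?E = {..?k} - {i. odd (c i)}" by auto
  have "card ?E = 2"
    unfolding E using d cells_support[OF c] cells_finite_odd[OF c]
    by (simp add: card_Diff_subset cell_dim_def)
  moreover have "b \<in> ?E" using bk be by auto
  ultimately have "card (?E - {b}) = 1" by simp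
  then obtain a where "?E - {b} = {a}" by (auto simp: card_1_singleton_iff)
  then have ab: "?E = {a, b}" "a \<noteq> b" using \<open>b \<in> ?E\<close> by auto
  have a: "a \<le> ?k" "even (c a)" using ab(1) by auto
  have oth: "\<bar>c i\<bar> \<noteq> 2 * p" if "i \<noteq> a" "i \<noteq> b" for i
  proof
    assume i: "\<bar>c i\<bar> = 2 * p"
    then have "even (c i)" by presburger
    moreover have "i \<le> ?k" using i p z[of i] by (cases "i \<le> ?k") auto
    ultimately have "i \<in> ?E" by auto
    with ab that show False by auto
  qed
  have fl: "face_le c (c(x := c x + v))" if "even (c x)" "v = 1 \<or> v = -1" for x v
    using that by (auto simp: face_le_def)
  have dm: "cell_dim (c(x := c x + v)) = ?k" if "even (c x)" "v = 1 \<or> v = -1" for x v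
    using cell_dim_upd[OF c that(1), of "c x + v"] that d by auto
  have top_cases: "\<exists>x\<in>{a, b}. \<exists>v\<in>{1, -1}. t = c(x := c x + v)" if "t \<in> tops p ?k c" for t
  proof -
    have "face_le c t" "t \<in> cells p ?k" "cell_dim t = Suc (cell_dim c)"
      using that d by (auto simp: tops_def)
    then obtain x v where "x \<le> ?k" "even (c x)" "v = 1 \<or> v = -1" "t = c(x := c x + v)"
      by (rule face_le_dim_Suc)
    then show ?thesis using ab(1) by blast
  qed
  have ain: "c(a := c a + v) \<in> cells p ?k \<longleftrightarrow> \<bar>c a + v\<bar> \<le> 2 * p" for v
  proof -
    have "\<bar>(c(a := c a + v)) b\<bar> = 2 * p" using b ab(2) by simp
    then have "\<exists>i. \<bar>(c(a := c a + v)) i\<bar> = 2 * p" by blast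
    moreover have "(\<forall>i. \<bar>(c(a := c a + v)) i\<bar> \<le> 2 * p) \<longleftrightarrow> \<bar>c a + v\<bar> \<le> 2 * p"
      using bd by (metis fun_upd_apply)
    moreover have "\<forall>i>?k. (c(a := c a + v)) i = 0" using a(1) z by simp
    ultimately show ?thesis unfolding cells_def by simp
  qed
  have bin: "c(b := c b + v) \<in> cells p ?k \<longleftrightarrow> \<bar>c b + v\<bar> \<le> 2 * p \<and> \<bar>c a\<bar> = 2 * p"
    if "v = 1 \<or> v = -1" for v
  proof -
    have "\<bar>c b + v\<bar> \<noteq> 2 * p" using be that by presburger
    then have "(\<exists>i. \<bar>(c(b := c b + v)) i\<bar> = 2 * p) \<longleftrightarrow> \<bar>c a\<bar> = 2 * p"
      using oth ab(2) by (metis fun_upd_apply)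
    then show ?thesis using bk bd z by (auto simp: cells_def split: if_splits)
  qed
  show ?thesis
  proof (cases "c ?k = 0")
    case True
    have "b \<noteq> ?k" using b p True by auto
    moreover have "?k \<in> {a, b}" unfolding ab(1)[symmetric] using True by simp
    ultimately have ak: "a = ?k" by simp
    have "t = c(?k := c ?k + 1)" if "t \<in> tops p ?k c" for t
    proof -
      from top_cases[OF that] obtain x v where xv: "x \<in> {a, b}" "v \<in> {1, -1}" "t = c(x := c x + v)" by blast
      have "t ?k > 0" using that by (auto simp: tops_def)
      then have "x = ?k" "v = 1" using xv True by (auto split: if_splits)
      then show ?thesis using xv by simp
    qed
    moreover have "c(?k := c ?k + 1) \<in> tops p ?k c"
      using ain[of 1] fl[of ?k 1] dm[of ?k 1] True p ak unfolding tops_def by auto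
    ultimately have "tops p ?k c = {c(?k := c ?k + 1)}" by blast
    then show ?thesis using True by simp
  next
    case False
    then have kpos: "c ?k > 0" using pos by simp
    \<comment> \<open>A positive even entry is at least 2, so a move by 1 keeps it positive.\<close>
    have sg: "(c(x := c x + v)) ?k > 0" if "even (c x)" "v = 1 \<or> v = -1" for x v
      using that kpos by (auto elim!: evenE)
    have top: "c(x := c x + v) \<in> tops p ?k c \<longleftrightarrow> c(x := c x + v) \<in> cells p ?k"
      if "x = a \<or> x = b" "v = 1 \<or> v = -1" for x v
      using fl[of x v] dm[of x v] sg[of x v] that a be by (auto simp: tops_def)
    show ?thesis
    proof (cases "\<bar>c a\<bar> = 2 * p")
      case lt: False
      then have "\<bar>c a\<bar> < 2 * p" using bd[of a] by simp
      then have "c(a := c a + 1) \<in> tops p ?k c" "c(a := c a + -1) \<in> tops p ?k c"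
        using top[of a 1] top[of a "-1"] ain[of 1] ain[of "-1"] by auto
      moreover have "c(b := c b + v) \<notin> tops p ?k c" if "v \<in> {1, -1}" for v
        using top[of b v] bin[of v] lt that by auto
      ultimately have "tops p ?k c = {c(a := c a + 1), c(a := c a + -1)}"
        using top_cases by blast
      moreover have "c(a := c a + 1) \<noteq> c(a := c a + -1)" by (metis fun_upd_same add_left_cancel one_neq_neg_one)
      ultimately show ?thesis using False by simp
    next
      case eq: True
      \<comment> \<open>\<open>u\<close> and \<open>w\<close> point inwards; the opposite moves
        leave the cube.\<close>
      define u where "u = - sgn (c a)"
      define w where "w = - sgn (c b)"
      have u: "u = 1 \<or> u = -1" "\<bar>c a + u\<bar> \<le> 2 * p" "\<not> \<bar>c a - u\<bar> \<le> 2 * p"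
        using eq p by (auto simp: u_def sgn_if)
      have w: "w = 1 \<or> w = -1" "\<bar>c b + w\<bar> \<le> 2 * p" "\<not> \<bar>c b - w\<bar> \<le> 2 * p"
        using b p by (auto simp: w_def sgn_if)
      have "c(a := c a + u) \<in> tops p ?k c" "c(b := c b + w) \<in> tops p ?k c"
        using top[of a u] top[of b w] ain[of u] bin[of w] u w eq by auto
      moreover have "c(a := c a + -u) \<notin> tops p ?k c" "c(b := c b + -w) \<notin> tops p ?k c"
        using top[of a "-u"] top[of b "-w"] ain[of "-u"] bin[of "-w"] u w eq by auto
      moreover have "{1, -1} = {u, -u}" "{1, -1} = {w, -w}" using u(1) w(1) by auto
      ultimately have "tops p ?k c = {c(a := c a + u), c(b := c b + w)}"
        using top_cases by (smt (verit) insertE insertCI singletonD subset_antisym subsetI)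
      moreover have "c(a := c a + u) \<noteq> c(b := c b + w)"
      proof
        assume "c(a := c a + u) = c(b := c b + w)"
        then have "(c(a := c a + u)) a = (c(b := c b + w)) a" by simp
        then show False using ab(2) u(1) by auto
      qed
      ultimately show ?thesis using False by simp
    qed
  qed
qed

section \<open>Tucker's lemma\<close>

lemma alternating_on_cong:
  assumes "\<And>i. i \<in> I \<Longrightarrow> lab i = lab' i"
  shows "alternating_on s lab I = alternating_on s lab' I"
proof -
  have "image_mset lab (mset_set I) = image_mset lab' (mset_set I)"
    using assms by (intro image_mset_cong) (metis elem_mset_set empty_iff infinite_set_mset_mset_set)
  then show ?thesis by (simp add: alternating_on_def)
qed

text \<open>Chains with one cell in each dimension below \<open>n\<close>, that is, simplices of the
  barycentric subdivision; for \<open>n = Suc k\<close> these are the top simplices. The value 0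
  from \<open>n\<close> on makes a flag determined by its cells, so that flags can be
  counted.\<close>

definition flags :: "int \<Rightarrow> nat \<Rightarrow> nat \<Rightarrow> (nat \<Rightarrow> cell) set" where
  "flags p k n = {f. (\<forall>i\<ge>n. f i = (\<lambda>_. 0)) \<and> (\<forall>i<n. f i \<in> cells p k \<and> cell_dim (f i) = i) \<and>
                     (\<forall>i. Suc i < n \<longrightarrow> face_le (f i) (f (Suc i)))}"

lemma finite_flags: "finite (flags p k n)"
proof -
  let ?F = "{f. \<forall>i. (i \<in> {..<n} \<longrightarrow> f i \<in> cells p k) \<and> (i \<notin> {..<n} \<longrightarrow> f i = (\<lambda>_. 0))}"
  have "finite ?F" by (rule finite_set_of_finite_funs) (simp_all add: finite_cells)
  moreover have "flags p k n \<subseteq> ?F" by (rule subsetI) (simp add: flags_def)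
  ultimately show ?thesis by (rule finite_subset[rotated])
qed

lemma flags_face:
  assumes "f \<in> flags p k n" "i \<le> j" "j < n"
  shows "face_le (f i) (f j)"
  using assms(2,3)
proof (induction j rule: dec_induct)
  case (step m)
  then have "face_le (f m) (f (Suc m))" using assms(1) by (simp add: flags_def)
  then show ?case using step face_le_trans by (meson Suc_lessD)
qed simp

text \<open>Between cells whose dimensions differ by two there are exactly two cells, with the same sum;
  likewise an edge has two endpoints.\<close>

definition swap_cell :: "nat \<Rightarrow> (nat \<Rightarrow> cell) \<Rightarrow> (nat \<Rightarrow> cell)" where
  "swap_cell i f = f(i := (\<lambda>x. (if i = 0 then f (Suc i) x else f (i - 1) x) + f (Suc i) x - f i x))"

lemma swap_cell:
  assumes f: "f \<in> flags p k n" and i: "Suc i < n"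
  shows "swap_cell i f \<in> flags p k n" "swap_cell i (swap_cell i f) = f" "swap_cell i f \<noteq> f"
proof -
  define new where "new = (\<lambda>x. (if i = 0 then f (Suc i) x else f (i - 1) x) + f (Suc i) x - f i x)"
  have swap: "swap_cell i f = f(i := new)" by (simp add: swap_cell_def new_def)
  have cl: "f j \<in> cells p k" "cell_dim (f j) = j" if "j < n" for j
    using f that by (simp_all add: flags_def)
  have fc: "face_le (f j) (f (Suc j))" if "Suc j < n" for j
    using f that by (simp add: flags_def)
  have up: "f i \<noteq> f (Suc i)" using cl(2)[of i] cl(2)[of "Suc i"] i by auto
  have new: "face_le new (f (Suc i)) \<and> cell_dim new = i \<and> new \<noteq> f i \<and> (i > 0 \<longrightarrow> face_le (f (i - 1)) new)"
  proof (cases i)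
    case 0
    have new0: "new = (\<lambda>x. f (Suc i) x + f (Suc i) x - f i x)" using 0 by (simp add: new_def)
    show ?thesis unfolding new0
      using reflect_face[OF fc[OF i]] up cl(2)[of i] i 0 by simp
  next
    case (Suc m)
    have fm: "face_le (f m) (f i)" using fc[of m] Suc i by simp
    have new1: "new = (\<lambda>x. f m x + f (Suc i) x - f i x)" using Suc by (simp add: new_def)
    have "f m \<noteq> f i" using cl(2)[of i] cl(2)[of m] i Suc by auto
    note * = middle_face[OF fm fc[OF i]] middle_face_dim[OF fm fc[OF i] cl(1)[OF i]]
      middle_face_neq[OF fm fc[OF i] this]
    show ?thesis unfolding new1
      using * cl(2)[of i] cl(2)[of m] cl(2)[of "Suc i"] i Suc by simp
  qed
  then have new_Suc: "face_le (f m) new" if "Suc m = i" for m using that by auto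
  have "new \<in> cells p k" using cells_face new cl(1)[OF i] by blast
  then show "swap_cell i f \<in> flags p k n"
    using new new_Suc f i unfolding swap by (auto simp: flags_def)
  show "swap_cell i (swap_cell i f) = f"
    by (cases i) (simp_all add: swap_cell_def fun_eq_iff)
  show "swap_cell i f \<noteq> f"
    using new unfolding swap by (metis fun_upd_same)
qed

text \<open>The facet that omits the cell of dimension \<open>i < k\<close> lies in exactly two
  flags. They share their top cell, hence their hemisphere, and cancel modulo 2.\<close>

lemma even_card_interior_facets:
  assumes "i < k"
  shows "even (card {f\<in>flags p k (Suc k). 0 < f k k \<and> alternating_on s (\<lambda>j. lab (f j)) ({..k} - {i})})"
    (is "even (card ?A)")
proof (rule even_card_involution[where h = "swap_cell i"])
  show "finite ?A" using finite_flags by (rule rev_finite_subset) blast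
  fix f assume "f \<in> ?A"
  then have f: "f \<in> flags p k (Suc k)" "0 < f k k" "alternating_on s (\<lambda>j. lab (f j)) ({..k} - {i})" by auto
  have "alternating_on s (\<lambda>j. lab (swap_cell i f j)) ({..k} - {i})"
    using f(3) by (subst alternating_on_cong[where lab' = "\<lambda>j. lab (f j)"]) (auto simp: swap_cell_def)
  moreover have "0 < swap_cell i f k k" using f(2) assms by (simp add: swap_cell_def)
  ultimately show "swap_cell i f \<in> ?A" using swap_cell(1)[OF f(1), of i] assms by simp
  show "swap_cell i (swap_cell i f) = f" "swap_cell i f \<noteq> f"
    using swap_cell(2,3)[OF f(1), of i] assms by simp_all
qed

text \<open>A face keeps even coordinates, in particular a coordinate 0, so a whole flag lies in the
  equator as soon as its last cell does.\<close>

lemma flags_equator: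
  assumes p: "p > 0"
  shows "{g\<in>flags p (Suc j) (Suc j). g j (Suc j) = 0} = flags p j (Suc j)"
proof -
  have eq: "c \<in> cells p (Suc j) \<and> c (Suc j) = 0 \<longleftrightarrow> c \<in> cells p j" for c
    unfolding cells_def by (auto simp: Suc_lessI not_less_eq) (metis Suc_lessI)
  show ?thesis
  proof (intro equalityI subsetI)
    fix g assume "g \<in> {g\<in>flags p (Suc j) (Suc j). g j (Suc j) = 0}"
    then have g: "g \<in> flags p (Suc j) (Suc j)" "g j (Suc j) = 0" by auto
    have "g i \<in> cells p j" if "i < Suc j" for i
    proof -
      have "face_le (g i) (g j)" using flags_face[OF g(1)] that by simp
      then have "g i (Suc j) = 0" using g(2) unfolding face_le_def by (metis even_zero)
      moreover have "g i \<in> cells p (Suc j)" using g(1) that by (simp add: flags_def)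
      ultimately show ?thesis using eq by blast
    qed
    then show "g \<in> flags p j (Suc j)" using g(1) by (simp add: flags_def)
  next
    fix g assume g: "g \<in> flags p j (Suc j)"
    then have "g i \<in> cells p j" if "i < Suc j" for i using that by (simp add: flags_def)
    then have "g i \<in> cells p (Suc j) \<and> g i (Suc j) = 0" if "i < Suc j" for i using that eq by blast
    then show "g \<in> {g\<in>flags p (Suc j) (Suc j). g j (Suc j) = 0}" using g by (simp add: flags_def)
  qed
qed

text \<open>Each cell of codimension one lies in two top cells of the closed upper hemisphere, except that a cell
  of the equator lies in only one.\<close>

lemma odd_card_boundary_facets:
  assumes p: "p > 0"
  shows "odd (card {f\<in>flags p (Suc j) (Suc (Suc j)). 0 < f (Suc j) (Suc j) \<and>
           alternating_on s (\<lambda>i. lab (f i)) ({..Suc j} - {Suc j})}) \<longleftrightarrow>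
         odd (card {f\<in>flags p j (Suc j). alternating_on s (\<lambda>i. lab (f i)) {..j}})"
proof -
  define F where "F = {f\<in>flags p (Suc j) (Suc (Suc j)). 0 < f (Suc j) (Suc j) \<and>
           alternating_on s (\<lambda>i. lab (f i)) ({..Suc j} - {Suc j})}"
  define G where "G = {g\<in>flags p (Suc j) (Suc j). alternating_on s (\<lambda>i. lab (g i)) {..j} \<and> g j (Suc j) \<ge> 0}"
  define r where "r = (\<lambda>f::nat \<Rightarrow> cell. f(Suc j := (\<lambda>_. 0)))"
  have fin: "finite F" "finite G" unfolding F_def G_def
    by (rule finite_subset[OF _ finite_flags]; blast)+
  have idx: "{..Suc j} - {Suc j} = {..j}" by auto
  have rG: "r f \<in> G" if "f \<in> F" for f
  proof -
    have f: "f \<in> flags p (Suc j) (Suc (Suc j))" "0 < f (Suc j) (Suc j)"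
      "alternating_on s (\<lambda>i. lab (f i)) {..j}" using that by (auto simp: F_def idx)
    have "alternating_on s (\<lambda>i. lab (r f i)) {..j}"
      using f(3) by (subst alternating_on_cong[where lab' = "\<lambda>i. lab (f i)"]) (auto simp: r_def)
    moreover have "face_le (f j) (f (Suc j))" using f(1) by (simp add: flags_def)
    then have "f j (Suc j) \<ge> 0" using f(2) unfolding face_le_def by (smt (verit))
    moreover have "r f \<in> flags p (Suc j) (Suc j)"
      using f(1) by (auto simp: flags_def r_def)
    ultimately show ?thesis by (simp add: G_def r_def)
  qed
  \<comment> \<open>\<open>r\<close> forgets the top cell, so the fibre over \<open>g\<close>
    consists of the possible top cells above \<open>g j\<close>.\<close>
  have fib: "card {f\<in>F. r f = g} = card (tops p (Suc j) (g j))" if g: "g \<in> G" for g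
  proof -
    have gz: "g (Suc j) = (\<lambda>_. 0)" using g by (simp add: G_def flags_def)
    have "bij_betw (\<lambda>t. g(Suc j := t)) (tops p (Suc j) (g j)) {f\<in>F. r f = g}"
    proof (rule bij_betwI[where g = "\<lambda>f. f (Suc j)"])
      show "(\<lambda>t. g(Suc j := t)) \<in> tops p (Suc j) (g j) \<rightarrow> {f\<in>F. r f = g}"
      proof
        fix t assume t: "t \<in> tops p (Suc j) (g j)"
        have "alternating_on s (\<lambda>i. lab ((g(Suc j := t)) i)) {..j}"
          using g by (subst alternating_on_cong[where lab' = "\<lambda>i. lab (g i)"]) (auto simp: G_def)
        moreover have "g(Suc j := t) \<in> flags p (Suc j) (Suc (Suc j))"
          using g t by (auto simp: G_def flags_def tops_def less_Suc_eq)
        moreover have "r (g(Suc j := t)) = g" using gz by (auto simp: r_def)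
        ultimately show "g(Suc j := t) \<in> {f\<in>F. r f = g}"
          using t by (simp add: F_def tops_def idx)
      qed
      show "(\<lambda>f. f (Suc j)) \<in> {f\<in>F. r f = g} \<rightarrow> tops p (Suc j) (g j)"
      proof
        fix f assume f: "f \<in> {f\<in>F. r f = g}"
        then have "g j = f j" by (auto simp: r_def)
        then show "f (Suc j) \<in> tops p (Suc j) (g j)" using f by (auto simp: F_def tops_def flags_def)
      qed
    qed (auto simp: r_def)
    then show ?thesis by (simp add: bij_betw_same_card)
  qed
  have tp: "card (tops p (Suc j) (g j)) = (if g j (Suc j) = 0 then 1 else 2)" if "g \<in> G" for g
    using that by (intro card_tops[OF p]) (auto simp: G_def flags_def)
  have "card F = (\<Sum>g\<in>G. card {f\<in>F. r f = g})"
    using sum.group[OF fin, of r "\<lambda>_. 1::nat"] rG by (simp add: image_subset_iff)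
  also have "\<dots> = (\<Sum>g\<in>G. if g j (Suc j) = 0 then 1 else 2)" using fib tp by (intro sum.cong refl) simp
  finally have "odd (card F) \<longleftrightarrow> odd (card {g\<in>G. odd (if g j (Suc j) = 0 then 1 else 2 :: nat)})"
    using even_sum_iff[OF fin(2), of "\<lambda>g. if g j (Suc j) = 0 then 1 else 2 :: nat"] by simp
  also have "{g\<in>G. odd (if g j (Suc j) = 0 then 1 else 2 :: nat)} =
      {f\<in>flags p j (Suc j). alternating_on s (\<lambda>i. lab (f i)) {..j}}"
    using flags_equator[OF p, of j] by (auto simp: G_def)
  finally show ?thesis by (simp only: F_def)
qed

lemma card_eq_sum_of_bool: "finite A \<Longrightarrow> card {x\<in>A. P x} = (\<Sum>x\<in>A. of_bool (P x))"
  by (simp add: Int_def)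

text \<open>Double count of the pairs of a flag in the upper hemisphere and an index whose omission
  leaves an \<open>s\<close>-alternating facet. Flag by flag, the parity is that of the alternating
  flags of either sign; index by index, interior facets cancel and the facets without top cell
  reduce to the equator.\<close>

lemma odd_card_alternating_hemisphere:
  assumes p: "p > 0"
  shows "odd (card {f\<in>flags p (Suc j) (Suc (Suc j)). 0 < f (Suc j) (Suc j) \<and>
           (alternating_on s (\<lambda>i. lab (f i)) {..Suc j} \<or> alternating_on (\<not> s) (\<lambda>i. lab (f i)) {..Suc j})}) \<longleftrightarrow>
         odd (card {f\<in>flags p j (Suc j). alternating_on s (\<lambda>i. lab (f i)) {..j}})"
proof -
  define H where "H = {f\<in>flags p (Suc j) (Suc (Suc j)). 0 < f (Suc j) (Suc j)}"
  define P where "P = (\<lambda>f i. alternating_on s (\<lambda>i. lab (f i)) ({..Suc j} - {i}))"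
  have fin: "finite H" unfolding H_def by (rule finite_subset[OF _ finite_flags]) blast
  have "odd (card {f\<in>H. odd (card {i\<in>{..Suc j}. P f i})}) \<longleftrightarrow> odd (\<Sum>f\<in>H. card {i\<in>{..Suc j}. P f i})"
    using even_sum_iff[OF fin, of "\<lambda>f. card {i\<in>{..Suc j}. P f i}"] by simp
  also have "(\<Sum>f\<in>H. card {i\<in>{..Suc j}. P f i}) = (\<Sum>f\<in>H. \<Sum>i\<in>{..Suc j}. of_bool (P f i))"
    by (intro sum.cong refl card_eq_sum_of_bool) simp
  also have "\<dots> = (\<Sum>i\<in>{..Suc j}. \<Sum>f\<in>H. of_bool (P f i))" by (rule sum.swap)
  also have "\<dots> = (\<Sum>i\<in>{..Suc j}. card {f\<in>H. P f i})"
    using fin by (intro sum.cong refl card_eq_sum_of_bool[symmetric])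
  also have "\<dots> = (\<Sum>i<Suc j. card {f\<in>H. P f i}) + card {f\<in>H. P f (Suc j)}"
    by (simp add: lessThan_Suc_atMost)
  also have "odd \<dots> \<longleftrightarrow> odd (card {f\<in>H. P f (Suc j)})"
  proof -
    have "even (card {f\<in>H. P f i})" if "i < Suc j" for i
      using even_card_interior_facets[OF that, of p s lab] by (simp add: H_def P_def)
    then have "even (\<Sum>i<Suc j. card {f\<in>H. P f i})" by (intro dvd_sum) simp
    then show ?thesis by simp
  qed
  also have "{f\<in>H. P f (Suc j)} = {f\<in>flags p (Suc j) (Suc (Suc j)). 0 < f (Suc j) (Suc j) \<and>
           alternating_on s (\<lambda>i. lab (f i)) ({..Suc j} - {Suc j})}"
    by (simp add: H_def P_def)
  also have "odd (card \<dots>) \<longleftrightarrow> odd (card {f\<in>flags p j (Suc j). alternating_on s (\<lambda>i. lab (f i)) {..j}})"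
    by (rule odd_card_boundary_facets[OF p])
  finally show ?thesis
    using odd_alternating_facets[of "{..Suc j}" s] by (simp add: H_def P_def)
qed

text \<open>A top cell has just one even coordinate, and that one must be extremal; a coordinate 0
  would be even without being extremal.\<close>

lemma flags_top_nonzero:
  assumes p: "p > 0" and f: "f \<in> flags p k (Suc k)"
  shows "f k k \<noteq> 0"
proof
  assume z: "f k k = 0"
  have c: "f k \<in> cells p k" "cell_dim (f k) = k" using f by (simp_all add: flags_def)
  have "{i. odd (f k i)} \<subseteq> {..<k}"
  proof
    fix i assume "i \<in> {i. odd (f k i)}"
    then have "i \<in> {..k}" "i \<noteq> k" using cells_support[OF c(1)] z by auto
    then show "i \<in> {..<k}" by simp
  qed
  then have "{i. odd (f k i)} = {..<k}"
    using c(2) by (intro card_subset_eq) (simp_all add: cell_dim_def)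
  moreover obtain i where i: "\<bar>f k i\<bar> = 2 * p" using c(1) by (auto simp: cells_def)
  then have "even (f k i)" by presburger
  moreover have "i < k"
    using i z p c(1) by (cases "i < k"; cases "i = k") (auto simp: cells_def)
  ultimately show False by auto
qed

text \<open>Fan's parity theorem. Negation carries the positively alternating flags of the lower
  hemisphere to the negatively alternating ones of the upper. So the count on the sphere equals the
  count of both signs on the upper hemisphere, which has the parity of the count on the equator. The
  induction starts at two antipodal points, exactly one of which has an even label.\<close>

lemma odd_card_alternating_flags:
  assumes p: "p > 0" and N: "k \<le> N"
    and anti: "\<And>c. c \<in> cells p N \<Longrightarrow> lab (\<lambda>i. - c i) = flip (lab c)"
    and compl: "\<And>c c'. c' \<in> cells p N \<Longrightarrow> face_le c c' \<Longrightarrow> lab c' \<noteq> flip (lab c)"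
  shows "odd (card {f\<in>flags p k (Suc k). alternating_on True (\<lambda>i. lab (f i)) {..k}})"
  using N
proof (induction k)
  case 0
  define v :: cell where "v = (\<lambda>i. if i = 0 then 2 * p else 0)"
  have v0: "\<bar>v 0\<bar> = 2 * p" "\<bar>- v 0\<bar> = 2 * p" using p by (simp_all add: v_def)
  have vc: "v \<in> cells p 0" "cell_dim v = 0"
    unfolding cells_def using v0(1) p by (auto simp: v_def cell_dim_def)
  have "c = v \<or> c = (\<lambda>i. - v i)" if c: "c \<in> cells p 0" for c
  proof -
    have z: "c i = 0" if "i > 0" for i using c that by (simp add: cells_def)
    obtain i where i: "\<bar>c i\<bar> = 2 * p" using c by (auto simp: cells_def)
    then have "i = 0" using z p by (cases "i = 0") auto
    then have "c 0 = 2 * p \<or> c 0 = - 2 * p" using i by auto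
    then show ?thesis using z by (auto simp: fun_eq_iff v_def)
  qed
  moreover have "(\<lambda>i. - v i) \<in> cells p 0" "cell_dim (\<lambda>i. - v i) = 0"
    unfolding cells_def using v0(2) p by (auto simp: v_def cell_dim_def)
  ultimately have fl: "flags p 0 (Suc 0) = {(\<lambda>_ _. 0)(0 := v), (\<lambda>_ _. 0)(0 := (\<lambda>i. - v i))}"
  proof -
    assume cs: "\<And>c. c \<in> cells p 0 \<Longrightarrow> c = v \<or> c = (\<lambda>i. - v i)"
      and n: "(\<lambda>i. - v i) \<in> cells p 0" "cell_dim (\<lambda>i. - v i) = 0"
    have f0: "f = (\<lambda>_ _. 0)(0 := f 0)" if "f \<in> flags p 0 (Suc 0)" for f
      using that by (simp add: flags_def fun_eq_iff[where f = f])
    have "f 0 = v \<or> f 0 = (\<lambda>i. - v i)" if "f \<in> flags p 0 (Suc 0)" for f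
      using that cs by (simp add: flags_def)
    then have "f \<in> {(\<lambda>_ _. 0)(0 := v), (\<lambda>_ _. 0)(0 := (\<lambda>i. - v i))}" if "f \<in> flags p 0 (Suc 0)" for f
      using f0[OF that] that by (metis insert_iff)
    moreover have "(\<lambda>_ _. 0)(0 := v) \<in> flags p 0 (Suc 0)" "(\<lambda>_ _. 0)(0 := (\<lambda>i. - v i)) \<in> flags p 0 (Suc 0)"
      using vc n by (simp_all add: flags_def)
    ultimately show ?thesis by blast
  qed
  have "v \<in> cells p N" using vc cells_mono by blast
  then have an: "lab (\<lambda>i. - v i) = flip (lab v)" by (rule anti)
  have alt: "alternating_on True (\<lambda>i. lab (f i)) {..0} \<longleftrightarrow> even (lab (f 0))" for f :: "nat \<Rightarrow> cell"
  proof -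
    have "{..0::nat} = {0}" by auto
    then show ?thesis by (simp add: alternating_on_def)
  qed
  have ne: "v \<noteq> (\<lambda>i. - v i)" using p by (auto simp: v_def fun_eq_iff)
  show ?case
  proof (cases "even (lab v)")
    case True
    then have "{f\<in>flags p 0 (Suc 0). alternating_on True (\<lambda>i. lab (f i)) {..0}} = {(\<lambda>_ _. 0)(0 := v)}"
      unfolding alt fl using an by auto
    then show ?thesis by simp
  next
    case False
    then have "{f\<in>flags p 0 (Suc 0). alternating_on True (\<lambda>i. lab (f i)) {..0}} = {(\<lambda>_ _. 0)(0 := (\<lambda>i. - v i))}"
      unfolding alt fl using an by auto
    then show ?thesis by simp
  qed
next
  case (Suc j)
  define A where "A = (\<lambda>s f. alternating_on s (\<lambda>i. lab (f i)) {..Suc j})"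
  define FL where "FL = flags p (Suc j) (Suc (Suc j))"
  have finFL: "finite FL" by (simp add: FL_def finite_flags)
  define neg where "neg = (\<lambda>(f::nat \<Rightarrow> cell) i x. - f i x)"
  have neg_FL: "neg f \<in> FL" if "f \<in> FL" for f
  proof -
    have "(\<lambda>x. - f i x) \<in> cells p (Suc j)" if "f i \<in> cells p (Suc j)" for i
      using that by (simp add: cells_def)
    moreover have "cell_dim (\<lambda>x. - f i x) = cell_dim (f i)" for i by (simp add: cell_dim_def)
    moreover have "face_le (\<lambda>x. - f i x) (\<lambda>x. - f (Suc i) x)" if "face_le (f i) (f (Suc i))" for i
      using that unfolding face_le_def by (smt (verit) even_minus)
    ultimately show ?thesis using \<open>f \<in> FL\<close> by (simp add: FL_def flags_def neg_def)
  qed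
  have neg_A: "A s (neg f) = A (\<not> s) f" if f: "f \<in> FL" for f s
  proof -
    have cl: "f i \<in> cells p N" if "i \<le> Suc j" for i
      using f that Suc.prems cells_mono[of "Suc j" N p] by (auto simp: FL_def flags_def)
    have "A s (neg f) = alternating_on s (\<lambda>i. flip (lab (f i))) {..Suc j}"
      unfolding A_def by (rule alternating_on_cong) (simp add: neg_def anti cl)
    also have "\<dots> = A (\<not> s) f" unfolding A_def
    proof (rule alternating_on_flip)
      fix i i' assume "i \<in> {..Suc j}" "i' \<in> {..Suc j}"
      then have "face_le (f i) (f i') \<or> face_le (f i') (f i)"
        using flags_face[OF f[unfolded FL_def]] by (metis atMost_iff le_imp_less_Suc nat_le_linear)
      then show "lab (f i') \<noteq> flip (lab (f i))"
        using compl cl \<open>i \<in> _\<close> \<open>i' \<in> _\<close> by (metis atMost_iff flip_flip)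
    qed simp
    finally show ?thesis .
  qed
  have "bij_betw neg {f\<in>FL. A True f \<and> f (Suc j) (Suc j) < 0} {f\<in>FL. A False f \<and> 0 < f (Suc j) (Suc j)}"
    by (rule bij_betwI[where g = neg]) (auto simp: neg_FL neg_A, auto simp: neg_def)
  then have b: "card {f\<in>FL. A True f \<and> f (Suc j) (Suc j) < 0} = card {f\<in>FL. A False f \<and> 0 < f (Suc j) (Suc j)}"
    by (rule bij_betw_same_card)
  have "{f\<in>FL. A True f} = {f\<in>FL. A True f \<and> f (Suc j) (Suc j) < 0} \<union> {f\<in>FL. A True f \<and> 0 < f (Suc j) (Suc j)}"
    using flags_top_nonzero[OF p, of _ "Suc j"] unfolding FL_def by fastforce
  also have "card \<dots> = card {f\<in>FL. A True f \<and> f (Suc j) (Suc j) < 0} + card {f\<in>FL. A True f \<and> 0 < f (Suc j) (Suc j)}"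
    using finFL by (intro card_Un_disjoint) auto
  also have "\<dots> = card ({f\<in>FL. A False f \<and> 0 < f (Suc j) (Suc j)} \<union> {f\<in>FL. A True f \<and> 0 < f (Suc j) (Suc j)})"
  proof -
    have "\<not> (A False f \<and> A True f)" for f
      using alternating_on_exclusive[of "{..Suc j}" True "\<lambda>i. lab (f i)"] unfolding A_def by auto
    then show ?thesis using finFL b by (subst card_Un_disjoint) auto
  qed
  also have "{f\<in>FL. A False f \<and> 0 < f (Suc j) (Suc j)} \<union> {f\<in>FL. A True f \<and> 0 < f (Suc j) (Suc j)} =
    {f\<in>FL. 0 < f (Suc j) (Suc j) \<and> (A True f \<or> A False f)}" by blast
  finally show ?case
    using odd_card_alternating_hemisphere[OF p, of j True lab] Suc
    by (simp add: FL_def A_def)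
qed

text \<open>An alternating flag has N + 1 distinct labels. If none of them were complementary, they
  would have N + 1 different absolute values, but only N are available.\<close>

theorem tucker_lemma:
  assumes p: "p > 0"
    and anti: "\<And>c. c \<in> cells p N \<Longrightarrow> lab (\<lambda>i. - c i) = flip (lab c)"
    and range: "\<And>c. c \<in> cells p N \<Longrightarrow> lab c < 2 * N"
  obtains c c' where "c \<in> cells p N" "c' \<in> cells p N" "face_le c c'" "lab c' = flip (lab c)"
proof -
  have False if compl: "\<And>c c'. c' \<in> cells p N \<Longrightarrow> face_le c c' \<Longrightarrow> lab c' \<noteq> flip (lab c)"
  proof -
    have "odd (card {f\<in>flags p N (Suc N). alternating_on True (\<lambda>i. lab (f i)) {..N}})"
      by (rule odd_card_alternating_flags[OF p order.refl]) (rule anti compl; assumption)+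
    then have "{f\<in>flags p N (Suc N). alternating_on True (\<lambda>i. lab (f i)) {..N}} \<noteq> {}"
      by (metis card.empty even_zero)
    then obtain f where f: "f \<in> flags p N (Suc N)" "alternating_on True (\<lambda>i. lab (f i)) {..N}" by blast
    have cl: "f i \<in> cells p N" if "i \<le> N" for i using f(1) that by (simp add: flags_def)
    have inj: "inj_on (\<lambda>i. lab (f i)) {..N}" by (rule alternating_on_inj[OF finite_atMost f(2)])
    have "inj_on (\<lambda>i. lab (f i) div 2) {..N}"
    proof (rule inj_onI)
      fix i i' assume i: "i \<in> {..N}" "i' \<in> {..N}" "lab (f i) div 2 = lab (f i') div 2"
      then have "face_le (f i) (f i') \<or> face_le (f i') (f i)"
        using flags_face[OF f(1)] by (metis atMost_iff le_imp_less_Suc nat_le_linear)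
      then have "lab (f i') \<noteq> flip (lab (f i))"
        using compl cl i(1,2) by (metis atMost_iff flip_flip)
      moreover have "x = y \<or> y = flip x" if "x div 2 = y div 2" for x y :: nat
        using that unfolding flip_def
        by (cases "even x"; cases "even y") (auto elim!: evenE oddE)
      ultimately have "lab (f i) = lab (f i')" using i(3) by blast
      then show "i = i'" using inj i by (auto dest: inj_onD)
    qed
    moreover have "(\<lambda>i. lab (f i) div 2) ` {..N} \<subseteq> {..<N}"
      using range[OF cl] by (auto simp: less_mult_imp_div_less mult.commute)
    ultimately have "card {..N} \<le> card {..<N}" by (rule card_inj_on_le) simp
    then show False by simp
  qed
  then show thesis using that cells_face by blast
qed

section \<open>The Borsuk--Ulam theorem\<close>

text \<open>If there were no such zero, \<open>G\<close> would be bounded away from 0 on the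
  boundary of a cube. Labelling a fine grid by a large coordinate of \<open>G\<close> and its sign,
  Tucker's lemma finds two nearby points where the same coordinate is large with opposite signs,
  against uniform continuity.\<close>

theorem borsuk_ulam_odd_zero:
  fixes G :: "'c::euclidean_space \<Rightarrow> 'd::euclidean_space"
  assumes dim: "DIM('c) = Suc (DIM('d))"
    and cont: "continuous_on UNIV G" and odd: "\<And>x. G (- x) = - G x"
  obtains x where "x \<noteq> 0" "G x = 0"
proof -
  have False if nz: "\<And>x. x \<noteq> 0 \<Longrightarrow> G x \<noteq> 0"
  proof -
    define N where "N = DIM('d)"
    have N: "N > 0" by (simp add: N_def)
    define B where "B = cbox (- One) (One :: 'c)"
    define K where "K = (\<Union>b\<in>Basis. B \<inter> {x::'c. \<bar>x \<bullet> b\<bar> = 1})"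
    have "compact K" unfolding K_def B_def
      by (intro compact_UN finite_Basis compact_Int_closed compact_cbox closed_Collect_eq continuous_intros)
    moreover have "K \<noteq> {}"
    proof -
      obtain b :: 'c where b: "b \<in> Basis" using nonempty_Basis by blast
      then have "(One::'c) \<in> B \<inter> {x. \<bar>x \<bullet> b\<bar> = 1}" by (simp add: B_def mem_box)
      then show ?thesis using b unfolding K_def by blast
    qed
    moreover have "continuous_on K (\<lambda>x. norm (G x))"
      by (intro continuous_on_norm continuous_on_subset[OF cont] subset_UNIV)
    ultimately obtain x0 where x0: "x0 \<in> K" "\<And>x. x \<in> K \<Longrightarrow> norm (G x0) \<le> norm (G x)"
      using continuous_attains_inf[of K "\<lambda>x. norm (G x)"] by metis
    have "x0 \<noteq> 0" using x0(1) by (auto simp: K_def)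
    then have m: "norm (G x0) > 0" using nz by simp
    \<comment> \<open>The absolute values of the N coordinates sum to at least the norm, so at every
      point of \<open>K\<close> one of them reaches \<open>\<delta>\<close>.\<close>
    define \<delta> where "\<delta> = norm (G x0) / real N"
    have \<delta>: "\<delta> > 0" using m N by (simp add: \<delta>_def)
    have big: "\<exists>b\<in>Basis. \<bar>G x \<bullet> b\<bar> \<ge> \<delta>" if "x \<in> K" for x
    proof (rule ccontr)
      assume "\<not> ?thesis"
      then have "(\<Sum>b\<in>Basis. \<bar>G x \<bullet> b\<bar>) < (\<Sum>b\<in>(Basis::'d set). \<delta>)"
        by (intro sum_strict_mono) auto
      also have "\<dots> = norm (G x0)" using N by (simp add: \<delta>_def N_def)
      finally show False using x0(2)[OF that] norm_le_l1[of "G x"] by linarith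
    qed
    have "uniformly_continuous_on B G"
      unfolding B_def by (intro compact_uniformly_continuous compact_cbox continuous_on_subset[OF cont] subset_UNIV)
    then obtain \<eta> where \<eta>: "\<eta> > 0" "\<And>x y. x \<in> B \<Longrightarrow> y \<in> B \<Longrightarrow> dist x y < \<eta> \<Longrightarrow> dist (G x) (G y) < \<delta>"
      using \<delta> unfolding uniformly_continuous_on_def by metis
    \<comment> \<open>A cell and its face differ by at most 1/(2q), half a grid step, in each of N +
      1 coordinates; this \<open>q\<close> makes the total less than \<open>\<eta>\<close>.\<close>
    obtain q :: nat where q: "real (Suc N) / \<eta> < real q" using reals_Archimedean2 by blast
    moreover have "real (Suc N) / \<eta> > 0" using \<eta>(1) by simp
    ultimately have q0: "real q > 0" by linarith
    have mesh: "real (Suc N) / (2 * real q) < \<eta>"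
    proof -
      have "real (Suc N) < real q * \<eta>" using q \<eta>(1) by (simp add: pos_divide_less_eq)
      also have "\<dots> \<le> \<eta> * (2 * real q)" using \<eta>(1) q0 by simp
      finally show ?thesis using q0 by (simp add: pos_divide_less_eq)
    qed
    define p where "p = int q"
    have p: "p > 0" using q0 by (simp add: p_def)
    obtain e where e: "bij_betw e {0..<Suc N} (Basis :: 'c set)"
      using ex_bij_betw_nat_finite[of "Basis :: 'c set"] dim by (auto simp: N_def)
    obtain u where u: "bij_betw u {0..<N} (Basis :: 'd set)"
      using ex_bij_betw_nat_finite[of "Basis :: 'd set"] by (auto simp: N_def)
    have eB: "e i \<in> Basis" if "i < Suc N" for i using e that by (auto simp: bij_betw_def)
    define pt where "pt = (\<lambda>c::cell. \<Sum>i\<in>{0..<Suc N}. (real_of_int (c i) / (2 * real q)) *\<^sub>R e i)"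
    have pt_e: "pt c \<bullet> e j = real_of_int (c j) / (2 * real q)" if j: "j < Suc N" for c j
    proof -
      have ee: "e i \<bullet> e j = (if i = j then 1 else 0)" if "i < Suc N" for i
        using inner_Basis[OF eB[OF that] eB[OF j]] e that j
        by (auto simp: bij_betw_def dest: inj_onD)
      have "pt c \<bullet> e j = (\<Sum>i\<in>{0..<Suc N}. (real_of_int (c i) / (2 * real q)) * (e i \<bullet> e j))"
        by (simp only: pt_def inner_sum_left inner_scaleR_left)
      also have "\<dots> = (\<Sum>i\<in>{0..<Suc N}. if i = j then real_of_int (c i) / (2 * real q) else 0)"
        by (intro sum.cong refl) (simp only: ee atLeastLessThan_iff, simp)
      also have "\<dots> = real_of_int (c j) / (2 * real q)" using j by (simp only: sum.delta finite_atLeastLessThan, simp)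
      finally show ?thesis .
    qed
    have Basis_e: "\<exists>i<Suc N. b = e i" if "b \<in> Basis" for b
      using that e by (auto simp: bij_betw_def image_iff) (metis atLeastLessThan_iff imageE)
    have pt_neg: "pt (\<lambda>i. - c i) = - pt c" for c
      by (simp add: pt_def sum_negf)
    have ptB: "pt c \<in> B" if "c \<in> cells p N" for c
    proof -
      have "\<bar>pt c \<bullet> b\<bar> \<le> 1" if "b \<in> Basis" for b
      proof -
        obtain i where i: "i < Suc N" "b = e i" using Basis_e[OF \<open>b \<in> Basis\<close>] by blast
        have "\<bar>c i\<bar> \<le> 2 * p" using \<open>c \<in> cells p N\<close> by (simp add: cells_def)
        then have "\<bar>real_of_int (c i)\<bar> \<le> 2 * real q" unfolding p_def by linarith
        then show ?thesis using i pt_e q0 by (simp add: abs_divide)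
      qed
      then show ?thesis by (auto simp: B_def mem_box abs_le_iff minus_le_iff)
    qed
    have ptK: "pt c \<in> K" if c: "c \<in> cells p N" for c
    proof -
      obtain i where i: "\<bar>c i\<bar> = 2 * p" using c by (auto simp: cells_def)
      then have "i < Suc N" using c p by (cases "i < Suc N") (auto simp: cells_def)
      moreover have "\<bar>real_of_int (c i)\<bar> = 2 * real q" using i unfolding p_def by linarith
      ultimately have "\<bar>pt c \<bullet> e i\<bar> = 1" using pt_e[of i c] q0 by (simp add: abs_divide)
      then show ?thesis using ptB[OF c] eB[OF \<open>i < Suc N\<close>] unfolding K_def by blast
    qed
    have pt_close: "dist (pt c) (pt c') < \<eta>" if "face_le c c'" for c c'
    proof -
      have "norm (pt c - pt c') \<le> (\<Sum>b\<in>Basis. \<bar>(pt c - pt c') \<bullet> b\<bar>)" by (rule norm_le_l1)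
      also have "\<dots> \<le> (\<Sum>b\<in>(Basis::'c set). 1 / (2 * real q))"
      proof (rule sum_mono)
        fix b :: 'c assume "b \<in> Basis"
        then obtain i where i: "i < Suc N" "b = e i" using Basis_e by blast
        have "\<bar>c i - c' i\<bar> \<le> 1" using that unfolding face_le_def by (smt (verit))
        then have "\<bar>real_of_int (c i) - real_of_int (c' i)\<bar> \<le> 1" by linarith
        moreover have "(pt c - pt c') \<bullet> b = (real_of_int (c i) - real_of_int (c' i)) / (2 * real q)"
          using i pt_e by (simp add: inner_diff_left diff_divide_distrib)
        ultimately show "\<bar>(pt c - pt c') \<bullet> b\<bar> \<le> 1 / (2 * real q)"
          using q0 by (simp add: abs_divide divide_right_mono)
      qed
      also have "\<dots> = real (Suc N) / (2 * real q)" using dim by (simp add: N_def)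
      finally show ?thesis using mesh by (simp add: dist_norm)
    qed
    \<comment> \<open>The condition involves absolute values only, so the least index is the same at
      antipodal cells.\<close>
    define ix where "ix = (\<lambda>c. LEAST i. i < N \<and> \<bar>G (pt c) \<bullet> u i\<bar> \<ge> \<delta>)"
    have ix: "ix c < N \<and> \<bar>G (pt c) \<bullet> u (ix c)\<bar> \<ge> \<delta>" if c: "c \<in> cells p N" for c
    proof -
      obtain b where "b \<in> Basis" "\<bar>G (pt c) \<bullet> b\<bar> \<ge> \<delta>" using big[OF ptK[OF c]] by blast
      moreover from this obtain i where "i < N" "b = u i"
        using u by (auto simp: bij_betw_def image_iff) (metis atLeastLessThan_iff imageE)
      ultimately show ?thesis unfolding ix_def by (intro LeastI) auto
    qed
    \<comment> \<open>The selected coordinate has absolute value at least \<open>\<delta>\<close>,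
      so the \<open>else\<close> branch means that it is negative.\<close>
    define lab where "lab = (\<lambda>c. 2 * ix c + (if G (pt c) \<bullet> u (ix c) > 0 then 0 else 1))"
    have anti: "lab (\<lambda>i. - c i) = flip (lab c)" if "c \<in> cells p N" for c
    proof -
      have "ix (\<lambda>i. - c i) = ix c" by (simp add: ix_def pt_neg odd)
      then show ?thesis
        using ix[OF that] \<delta> by (auto simp: lab_def pt_neg odd flip_def)
    qed
    have range: "lab c < 2 * N" if "c \<in> cells p N" for c
      using ix[OF that] by (simp add: lab_def)
    obtain c c' where cc: "c \<in> cells p N" "c' \<in> cells p N" "face_le c c'" "lab c' = flip (lab c)"
      using tucker_lemma[of p N lab] p anti range by blast
    define s where "s = G (pt c) \<bullet> u (ix c)"
    define s' where "s' = G (pt c') \<bullet> u (ix c')"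
    have parity: "a = b \<and> (P' \<longleftrightarrow> \<not> P)"
      if "2 * a + (if P' then 0 else 1) = flip (2 * b + (if P then 0 else 1))" for a b P P'
      using that unfolding flip_def by (cases P; cases P') (simp_all, presburger+)
    have "ix c' = ix c \<and> (s' > 0 \<longleftrightarrow> \<not> s > 0)"
      using cc(4) unfolding lab_def s_def[symmetric] s'_def[symmetric] by (rule parity)
    moreover have "\<bar>s\<bar> \<ge> \<delta>" "\<bar>s'\<bar> \<ge> \<delta>" using ix[OF cc(1)] ix[OF cc(2)] by (simp_all add: s_def s'_def)
    ultimately have "\<bar>(G (pt c) - G (pt c')) \<bullet> u (ix c)\<bar> \<ge> \<delta>"
      by (auto simp: s_def s'_def inner_diff_left)
    moreover have "u (ix c) \<in> Basis" using ix[OF cc(1)] u by (auto simp: bij_betw_def)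
    then have "\<bar>(G (pt c) - G (pt c')) \<bullet> u (ix c)\<bar> \<le> dist (G (pt c)) (G (pt c'))"
      unfolding dist_norm by (rule Basis_le_norm)
    moreover have "dist (G (pt c)) (G (pt c')) < \<delta>"
      using \<eta>(2) ptB cc pt_close by blast
    ultimately show False by linarith
  qed
  then show thesis using that by blast
qed

section \<open>Complete partite subsystems\<close>

text \<open>With t = d - 2 the left side is the tangent to t^3 at \<open>s\<close>: the difference
  is (t - s)^2 (t + 2s). Summed with \<open>s\<close> at the mean, it does the work of Jensen's
  inequality for the number of ordered triples.\<close>

lemma cube_tangent:
  fixes s :: real
  assumes "s \<ge> 0"
  shows "3 * s\<^sup>2 * (real d - 2) - 2 * s ^ 3 \<le> real (if d \<ge> 3 then d * (d - 1) * (d - 2) else 0)"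
proof (cases "d \<ge> 3")
  case True
  define t where "t = real d - 2"
  have t: "t \<ge> 1" using True by (simp add: t_def)
  have "(t - s)\<^sup>2 * (t + 2 * s) \<ge> 0" using t assms by simp
  then have "3 * s\<^sup>2 * t - 2 * s ^ 3 \<le> t ^ 3"
    by (simp add: power2_eq_square power3_eq_cube algebra_simps)
  also have "t ^ 3 \<le> (t + 2) * (t + 1) * t"
    using t by (simp add: power3_eq_cube mult_mono)
  also have "\<dots> = real (d * (d - 1) * (d - 2))"
    using True by (simp add: t_def of_nat_diff)
  finally show ?thesis using True by (simp add: t_def)
next
  case False
  then have "3 * s\<^sup>2 * (real d - 2) \<le> 0" by (intro mult_nonneg_nonpos) auto
  moreover have "s ^ 3 \<ge> 0" using assms by simp
  ultimately show ?thesis using False by (simp only: if_False of_nat_0)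
qed

lemma card_distinct_triples:
  assumes "finite A"
  shows "card {ys. length ys = 3 \<and> distinct ys \<and> set ys \<subseteq> A} =
         (if card A \<ge> 3 then card A * (card A - 1) * (card A - 2) else 0)"
proof (cases "card A \<ge> 3")
  case True
  then obtain k where k: "card A = k + 3" by (metis add.commute le_Suc_ex)
  have "{card A - 3 + 1..card A} = {k + 1, k + 2, k + 3}" using k by auto
  then show ?thesis using card_lists_distinct_length_eq[OF assms True] k by simp
next
  case False
  have "ys \<notin> {ys. length ys = 3 \<and> distinct ys \<and> set ys \<subseteq> A}" for ys
  proof
    assume "ys \<in> {ys. length ys = 3 \<and> distinct ys \<and> set ys \<subseteq> A}"
    then have "card (set ys) = 3" "set ys \<subseteq> A" by (auto simp: distinct_card)
    then show False using False assms card_mono by metis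
  qed
  then have "{ys. length ys = 3 \<and> distinct ys \<and> set ys \<subseteq> A} = {}" by blast
  then show ?thesis using False by (simp only: card.empty if_False)
qed

text \<open>With X = n^(1 - e/3) the hypothesis says s^3 <= 2 X^3. The constant 2 reproduces itself:
  s <= 3X/2 because 2 <= 27/8, and the shift 2 is at most X/2 because X >= n^(2/3) >= 4.\<close>

lemma kst_estimate:
  fixes n s M e :: real
  assumes n: "n \<ge> 8" and e: "0 \<le> e" "e \<le> 1" and M: "M > 0" and s: "s \<ge> 0"
    and le: "M * s ^ 3 \<le> n ^ 3 * (2 * (M * n powr (- e)))"
  shows "M * (s + 2) \<le> 2 * (M * n powr (1 - e / 3))"
proof -
  define X where "X = n powr (1 - e / 3)"
  have "X ^ 3 = n powr (3 - e)"
    using n by (simp add: X_def powr_power)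
  also have "\<dots> = n ^ 3 * n powr (- e)"
    using n by (simp add: powr_diff powr_minus divide_inverse powr_numeral)
  finally have X3: "X ^ 3 = n ^ 3 * n powr (- e)" .
  have "X > 0" using n by (simp add: X_def)
  have "M * s ^ 3 \<le> M * (2 * X ^ 3)" using le by (simp add: X3 algebra_simps)
  then have "s ^ 3 \<le> 2 * X ^ 3" using M by simp
  also have "\<dots> \<le> (3 / 2 * X) ^ 3" using \<open>X > 0\<close> by (simp add: power_mult_distrib power3_eq_cube)
  finally have sX: "s \<le> 3 / 2 * X" using \<open>X > 0\<close> by (simp add: power_mono_iff s)
  have "4 = (8::real) powr (2 / 3)"
  proof -
    have "(8::real) = 2 powr 3" by (simp add: powr_numeral)
    then have "(8::real) powr (2 / 3) = (2 powr 3) powr (2 / 3)" by simp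
    also have "\<dots> = 2 powr 2" by (simp only: powr_powr) simp
    finally show ?thesis by (simp add: powr_numeral)
  qed
  also have "\<dots> \<le> n powr (2 / 3)" using n by (intro powr_mono2) auto
  also have "\<dots> \<le> X" unfolding X_def using n e by (intro powr_mono) auto
  finally have "s + 2 \<le> 2 * X" using sX by simp
  then show ?thesis using M by (simp add: X_def[symmetric])
qed

text \<open>A complete partite system with \<open>m\<close> parts of size 3, in ordered form.
  Disjointness of the parts is not imposed: it will follow from the lists in \<open>T\<close> being
  distinct.\<close>

definition has_box :: "'v set \<Rightarrow> nat \<Rightarrow> 'v list set \<Rightarrow> bool" where
  "has_box V m T \<longleftrightarrow> (\<exists>As. length As = m \<and> (\<forall>A\<in>set As. A \<subseteq> V \<and> card A = 3) \<and> listset As \<subseteq> T)"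

lemma has_box_mono: "has_box V m S \<Longrightarrow> S \<subseteq> T \<Longrightarrow> has_box V m T"
  unfolding has_box_def by (metis order.trans)

text \<open>The constant 2 is kept through the induction: for \<open>n \<le> 8\<close> the bound is weaker than \<open>n\<^sup>m\<close>, and for \<open>n \<ge> 8\<close>
  the Kovari--Sos--Turan double count over triples of first coordinates closes the step.\<close>

theorem erdos_box:
  assumes V: "finite V" and m: "m \<ge> 1" and T: "T \<subseteq> {xs. set xs \<subseteq> V \<and> length xs = m}"
    and nb: "\<not> has_box V m T"
  shows "real (card T) \<le> 2 * real (card V) powr (real m - 3 powr (1 - real m))"
  using m T nb
proof (induction m arbitrary: T rule: nat_induct_at_least)
  case base
  define X where "X = {x. [x] \<in> T}"
  have TX: "T = (\<lambda>x. [x]) ` X"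
    using base(1) by (auto simp: X_def length_Suc_conv image_iff)
  have XV: "X \<subseteq> V" using base(1) by (auto simp: X_def)
  have "\<not> card X \<ge> 3"
  proof
    assume "card X \<ge> 3"
    then obtain A where "A \<subseteq> X" "card A = 3" by (meson obtain_subset_with_card_n)
    then have "length [A] = 1 \<and> (\<forall>B\<in>set [A]. B \<subseteq> V \<and> card B = 3) \<and> listset [A] \<subseteq> T"
      using XV by (auto simp: set_Cons_def X_def)
    then show False using base(2) unfolding has_box_def by blast
  qed
  moreover have "card T = card X" unfolding TX by (rule card_image) (simp add: inj_on_def)
  \<comment> \<open>At m = 1 the exponent is 0, and \<open>0 powr 0 = 0\<close> in HOL, so the bound
    is 2 only if \<open>V\<close> is nonempty.\<close>
  moreover have "X = {}" if "card V = 0" using that XV V by auto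
  ultimately show ?case by (cases "card V = 0") auto
next
  case (Suc m)
  define n where "n = real (card V)"
  define e where "e = 3 powr (1 - real m)"
  have e: "0 \<le> e" "e \<le> 1"
    using powr_mono[of "1 - real m" 0 "3::real"] Suc.hyps by (simp_all add: e_def)
  have e': "3 powr (1 - real (Suc m)) = e / 3"
  proof -
    have "1 - real (Suc m) = (1 - real m) - 1" by simp
    then show ?thesis by (simp only: e_def powr_diff) simp
  qed
  define L where "L = {xs. set xs \<subseteq> V \<and> length xs = m}"
  have finL: "finite L" using V by (simp add: L_def finite_lists_length_eq)
  have cL: "real (card L) = n ^ m" using V by (simp add: L_def n_def card_lists_length_eq)
  define N where "N = (\<lambda>xs. {y\<in>V. y # xs \<in> T})"
  have finN: "finite (N xs)" for xs using V by (simp add: N_def)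
  have finT: "finite T"
    using Suc.prems(1) finite_subset[OF _ finite_lists_length_eq[OF V]] by metis
  have cT: "card T = (\<Sum>xs\<in>L. card (N xs))"
  proof -
    have "bij_betw (\<lambda>(xs, y). y # xs) (Sigma L N) T"
    proof (rule bij_betwI[where g = "\<lambda>zs. (tl zs, hd zs)"])
      show "(\<lambda>zs. (tl zs, hd zs)) \<in> T \<rightarrow> Sigma L N"
      proof
        fix zs assume z: "zs \<in> T"
        then have "set zs \<subseteq> V" "length zs = Suc m" using Suc.prems(1) by auto
        then show "(tl zs, hd zs) \<in> Sigma L N" using z by (cases zs) (auto simp: L_def N_def)
      qed
      show "(case (tl zs, hd zs) of (xs, y) \<Rightarrow> y # xs) = zs" if "zs \<in> T" for zs
        using that Suc.prems(1) by (cases zs) auto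
    qed (auto simp: N_def)
    then have "card T = card (Sigma L N)" by (simp add: bij_betw_same_card)
    then show ?thesis using finL finN by simp
  qed
  consider "card V = 0" | "card V \<ge> 1" "card V \<le> 8" | "card V \<ge> 8" by linarith
  then show ?case
  proof cases
    case 1
    then have "T = {}" using V Suc.prems(1) by (auto simp: length_Suc_conv)
    then show ?thesis by simp
  next
    case 2
    have n1: "n \<ge> 1" using 2 by (simp add: n_def)
    have "real (card T) \<le> n ^ Suc m"
    proof -
      have "card T \<le> card {xs. set xs \<subseteq> V \<and> length xs = Suc m}"
        using Suc.prems(1) V by (intro card_mono finite_lists_length_eq) auto
      also have "\<dots> = card V ^ Suc m" using V by (rule card_lists_length_eq)
      finally show ?thesis unfolding n_def by (metis of_nat_le_iff of_nat_power)
    qed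
    also have "n ^ Suc m = n powr (real (Suc m) - e / 3) * n powr (e / 3)"
      using n1 by (simp add: powr_realpow flip: powr_add del: power_Suc of_nat_Suc)
    also have "\<dots> \<le> n powr (real (Suc m) - e / 3) * 2"
    proof (rule mult_left_mono)
      have "n powr (e / 3) \<le> n powr (1 / 3)" using n1 e by (intro powr_mono) auto
      also have "\<dots> \<le> 8 powr (1 / 3)" using n1 2 by (intro powr_mono2) (auto simp: n_def)
      also have "(8::real) = 2 powr 3" by (simp add: powr_numeral)
      also have "(2 powr 3) powr (1 / 3) = (2::real)" by (simp only: powr_powr) simp
      finally show "n powr (e / 3) \<le> 2" .
    qed simp
    finally show ?thesis unfolding e' by (simp add: n_def)
  next
    case 3
    have n8: "n \<ge> 8" using 3 by (simp add: n_def)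
    define Y where "Y = {ys. length ys = 3 \<and> distinct ys \<and> set ys \<subseteq> V}"
    have finY: "finite Y"
      by (rule finite_subset[OF _ finite_lists_length_eq[OF V, of 3]]) (auto simp: Y_def)
    have cY: "real (card Y) \<le> n ^ 3"
    proof -
      have "card Y \<le> card {xs. set xs \<subseteq> V \<and> length xs = 3}"
        using V by (intro card_mono finite_lists_length_eq) (auto simp: Y_def)
      also have "\<dots> = card V ^ 3" using V by (rule card_lists_length_eq)
      finally show ?thesis unfolding n_def by (metis of_nat_le_iff of_nat_power)
    qed
    \<comment> \<open>A box among the common tails of a triple becomes a box in \<open>T\<close>
      with that triple as its first part, so the induction hypothesis bounds the tails.\<close>
    have codeg: "real (card {xs\<in>L. \<forall>y\<in>set ys. y # xs \<in> T}) \<le> 2 * (n ^ m * n powr (- e))"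
      if ys: "ys \<in> Y" for ys
    proof -
      have "\<not> has_box V m {xs\<in>L. \<forall>y\<in>set ys. y # xs \<in> T}"
      proof
        assume "has_box V m {xs\<in>L. \<forall>y\<in>set ys. y # xs \<in> T}"
        then obtain As where As: "length As = m" "\<forall>A\<in>set As. A \<subseteq> V \<and> card A = 3"
          "listset As \<subseteq> {xs\<in>L. \<forall>y\<in>set ys. y # xs \<in> T}" unfolding has_box_def by blast
        have "card (set ys) = 3" "set ys \<subseteq> V" using ys by (auto simp: Y_def distinct_card)
        moreover have "listset (set ys # As) \<subseteq> T" using As(3) by (auto simp: set_Cons_def)
        ultimately have "has_box V (Suc m) T"
          unfolding has_box_def using As by (intro exI[of _ "set ys # As"]) auto
        then show False using Suc.prems(2) by blast
      qed
      then have "real (card {xs\<in>L. \<forall>y\<in>set ys. y # xs \<in> T}) \<le> 2 * n powr (real m - e)"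
        unfolding n_def e_def by (intro Suc.IH) (auto simp: L_def)
      also have "n powr (real m - e) = n ^ m * n powr (- e)"
        using n8 by (simp add: powr_diff powr_minus divide_inverse powr_realpow)
      finally show ?thesis .
    qed
    define M where "M = n ^ m"
    have M: "M > 0" using n8 by (simp add: M_def)
    define D where "D = real (card T)"
    \<comment> \<open>The mean of \<open>card (N xs) - 2\<close>; with this tangent point the
      tangent bounds sum to exactly M s^3.\<close>
    define s where "s = D / M - 2"
    have D: "D = M * (s + 2)" using M by (simp add: s_def)
    have key: "D \<le> 2 * (M * n powr (1 - e / 3))"
    proof (cases "s \<ge> 0")
      case True
      have "M * s ^ 3 = 3 * s\<^sup>2 * (D - 2 * M) - 2 * s ^ 3 * M"
        unfolding D by (simp add: power2_eq_square power3_eq_cube algebra_simps)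
      also have "\<dots> = (\<Sum>xs\<in>L. 3 * s\<^sup>2 * (real (card (N xs)) - 2) - 2 * s ^ 3)"
        using cL by (simp add: D_def cT M_def sum_subtractf flip: sum_distrib_left)
      also have "\<dots> \<le> (\<Sum>xs\<in>L. real (card {ys. length ys = 3 \<and> distinct ys \<and> set ys \<subseteq> N xs}))"
        by (intro sum_mono) (simp only: card_distinct_triples[OF finN] cube_tangent[OF True])
      also have "\<dots> = (\<Sum>xs\<in>L. \<Sum>ys\<in>Y. of_bool (\<forall>y\<in>set ys. y # xs \<in> T))"
      proof (intro sum.cong refl)
        fix xs assume "xs \<in> L"
        have "{ys. length ys = 3 \<and> distinct ys \<and> set ys \<subseteq> N xs} = {ys\<in>Y. \<forall>y\<in>set ys. y # xs \<in> T}"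
          by (auto simp: Y_def N_def)
        then show "real (card {ys. length ys = 3 \<and> distinct ys \<and> set ys \<subseteq> N xs}) =
          (\<Sum>ys\<in>Y. of_bool (\<forall>y\<in>set ys. y # xs \<in> T))" using finY by (simp add: Int_def)
      qed
      also have "\<dots> = (\<Sum>ys\<in>Y. \<Sum>xs\<in>L. of_bool (\<forall>y\<in>set ys. y # xs \<in> T))" by (rule sum.swap)
      also have "\<dots> = (\<Sum>ys\<in>Y. real (card {xs\<in>L. \<forall>y\<in>set ys. y # xs \<in> T}))"
        using finL by (simp add: Int_def)
      also have "\<dots> \<le> (\<Sum>ys\<in>Y. 2 * (M * n powr (- e)))"
        unfolding M_def using codeg by (rule sum_mono)
      also have "\<dots> = real (card Y) * (2 * (M * n powr (- e)))" by simp
      also have "\<dots> \<le> n ^ 3 * (2 * (M * n powr (- e)))"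
        using cY M by (intro mult_right_mono) auto
      finally show ?thesis unfolding D by (rule kst_estimate[OF n8 e M True])
    next
      case False
      then have "D \<le> M * 2" unfolding D using M by simp
      also have "\<dots> \<le> M * (2 * n powr (1 - e / 3))"
        using M n8 e by (intro mult_left_mono) (auto intro: ge_one_powr_ge_zero)
      finally show ?thesis by (simp add: algebra_simps)
    qed
    have "n powr (real (Suc m) - e / 3) = M * n powr (1 - e / 3)"
      using n8 by (simp add: M_def powr_realpow[symmetric] add_diff_eq add.commute flip: powr_add)
    then show ?thesis using key unfolding e' D_def n_def[symmetric] by simp
  qed
qed

text \<open>The prefix \<open>zs\<close> stands for parts of size 1 and contributes a factor n^a.
  Each edge is counted by all its (a + m)! >= 2 orderings, which absorbs the constant 2 of
  \<open>erdos_box\<close>.\<close>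

theorem card_le_of_no_box:
  fixes F :: "'v set set"
  assumes V: "finite V" and F: "\<And>e. e \<in> F \<Longrightarrow> e \<subseteq> V \<and> card e = a + m" and m: "m \<ge> 1" and r: "a + m \<ge> 2"
    and nb: "\<And>zs. length zs = a \<Longrightarrow> \<not> has_box V m {ys. distinct (zs @ ys) \<and> set (zs @ ys) \<in> F \<and> length ys = m}"
  shows "real (card F) \<le> real (card V) powr (real (a + m) - 3 powr (1 - real m))"
proof (cases "card V = 0")
  case True
  then have "F = {}" using V F r by fastforce
  then show ?thesis by simp
next
  case False
  define n where "n = real (card V)"
  define e where "e = 3 powr (1 - real m)"
  have n: "n > 0" using False by (simp add: n_def)
  define S where "S = (\<Union>f\<in>F. permutations_of_set f)"
  have fin: "finite f" if "f \<in> F" for f using F[OF that] V finite_subset by blast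
  have finF: "finite F" by (rule finite_subset[of _ "Pow V"]) (use F V in auto)
  have "card S = (\<Sum>f\<in>F. card (permutations_of_set f))"
    unfolding S_def using finF
    by (intro card_UN_disjoint) (simp_all, auto simp: permutations_of_set_def)
  also have "\<dots> = card F * fact (a + m)" using F fin by simp
  finally have cS: "card S = card F * fact (a + m)" .
  define Ls where "Ls = {zs. set zs \<subseteq> V \<and> length zs = a}"
  have finLs: "finite Ls" using V by (simp add: Ls_def finite_lists_length_eq)
  define Q where "Q = (\<lambda>zs. {ys. distinct (zs @ ys) \<and> set (zs @ ys) \<in> F \<and> length ys = m})"
  have QL: "Q zs \<subseteq> {xs. set xs \<subseteq> V \<and> length xs = m}" for zs using F by (auto simp: Q_def)
  have finQ: "finite (Q zs)" for zs
    using finite_subset[OF QL finite_lists_length_eq[OF V]] .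
  have "S \<subseteq> (\<lambda>(zs, ys). zs @ ys) ` Sigma Ls Q"
  proof
    fix xs assume "xs \<in> S"
    then have xs: "set xs \<in> F" "distinct xs" by (auto simp: S_def permutations_of_set_def)
    then have l: "length xs = a + m" "set xs \<subseteq> V" using F[OF xs(1)] by (auto simp: distinct_card)
    have "set (take a xs) \<subseteq> V" by (rule order.trans[OF set_take_subset l(2)])
    then have "(take a xs, drop a xs) \<in> Sigma Ls Q" 
      unfolding Ls_def Q_def using xs l by (simp del: set_append distinct_append)
    then show "xs \<in> (\<lambda>(zs, ys). zs @ ys) ` Sigma Ls Q" by (rule image_eqI[rotated]) simp
  qed
  then have "card S \<le> card (Sigma Ls Q)"
    using finLs finQ by (meson finite_SigmaI surj_card_le)
  also have "\<dots> = (\<Sum>zs\<in>Ls. card (Q zs))" using finLs finQ by simp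
  finally have "real (card S) \<le> (\<Sum>zs\<in>Ls. real (card (Q zs)))"
    by (simp only: of_nat_le_iff flip: of_nat_sum)
  also have "\<dots> \<le> (\<Sum>zs\<in>Ls. 2 * n powr (real m - e))"
  proof (rule sum_mono)
    fix zs assume "zs \<in> Ls"
    then show "real (card (Q zs)) \<le> 2 * n powr (real m - e)"
      unfolding n_def e_def using nb by (intro erdos_box[OF V m QL]) (simp add: Q_def Ls_def)
  qed
  also have "\<dots> = n ^ a * (2 * n powr (real m - e))"
    using V by (simp add: Ls_def card_lists_length_eq n_def)
  also have "\<dots> = 2 * n powr (real (a + m) - e)"
    using n by (simp add: powr_realpow[symmetric] add_diff_eq flip: powr_add)
  finally have "real (card F) * fact (a + m) \<le> 2 * n powr (real (a + m) - e)" by (simp add: cS)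
  moreover have "real (card F) * 2 \<le> real (card F) * fact (a + m)"
  proof (rule mult_left_mono)
    have "(fact 2 :: real) \<le> fact (a + m)" by (intro fact_mono r)
    then show "2 \<le> (fact (a + m) :: real)" by (simp add: fact_2)
  qed simp
  ultimately show ?thesis unfolding n_def e_def by linarith
qed

section \<open>Counting weak colorings\<close>

definition weak_colorings :: "nat \<Rightarrow> 'v set set \<Rightarrow> 'v set \<Rightarrow> ('v \<Rightarrow> nat) set" where
  "weak_colorings c E W = {f \<in> W \<rightarrow>\<^sub>E {1..c}. \<forall>e\<in>E. e \<subseteq> W \<longrightarrow> card (f ` e) > 1}"

lemma finite_weak_colorings: "finite W \<Longrightarrow> finite (weak_colorings c E W)"
  by (simp add: weak_colorings_def finite_PiE)

lemma iterate_growth: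
  fixes P :: "'v set \<Rightarrow> real"
  assumes "finite S" "S \<subseteq> U" "\<beta> \<ge> 0"
    and step: "\<And>W v. W \<subseteq> U \<Longrightarrow> v \<in> W \<Longrightarrow> \<beta> * P (W - {v}) \<le> P W"
  shows "\<beta> ^ card S * P (U - S) \<le> P U"
  using assms(1,2)
proof (induction S)
  case (insert x S)
  have "\<beta> * P (U - S - {x}) \<le> P (U - S)" using insert by (intro step) auto
  then have "\<beta> ^ card S * (\<beta> * P (U - S - {x})) \<le> \<beta> ^ card S * P (U - S)"
    using assms(3) by (intro mult_left_mono) auto
  also have "\<dots> \<le> P U" using insert by simp
  finally have "\<beta> ^ card S * (\<beta> * P (U - S - {x})) \<le> P U" .
  moreover have "U - S - {x} = U - insert x S" by blast
  ultimately show ?case using insert.hyps by (simp add: mult.assoc mult.left_commute)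
qed simp

text \<open>The color of \<open>w\<close> determines all of \<open>e\<close>. Since
  \<open>w \<noteq> v\<close>, the remaining vertex set avoids \<open>v\<close>, so the restriction
  to it inherits weak colorability from \<open>W - {v}\<close>.\<close>

lemma card_monochromatic_extensions:
  assumes W: "finite W" and e: "e \<in> E" "e \<subseteq> W" and v: "v \<in> e" and w: "w \<in> e" "w \<noteq> v"
  shows "card {g \<in> W \<rightarrow>\<^sub>E {1..c}. restrict g (W - {v}) \<in> weak_colorings c E (W - {v}) \<and> card (g ` e) \<le> 1}
         \<le> card (weak_colorings c E (W - (e - {w})))" (is "card ?B \<le> card ?C")
proof (rule card_inj_on_le)
  let ?U = "W - (e - {w})"
  have mono: "g x = g w" if "g \<in> ?B" "x \<in> e" for g x
  proof -
    have "finite (g ` e)" using e W finite_subset by blast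
    moreover have "card (g ` e) \<le> Suc 0" using that(1) by simp
    ultimately have "\<forall>a\<in>g ` e. \<forall>b\<in>g ` e. a = b" by (simp only: card_le_Suc0_iff_eq)
    then show ?thesis using that(2) w(1) by blast
  qed
  show "inj_on (\<lambda>g. restrict g ?U) ?B"
  proof (rule inj_onI)
    fix g h assume g: "g \<in> ?B" and h: "h \<in> ?B" and eq: "restrict g ?U = restrict h ?U"
    have eqU: "g x = h x" if "x \<in> ?U" for x using fun_cong[OF eq, of x] that by simp
    have wU: "w \<in> ?U" using w e by auto
    show "g = h"
    proof
      fix x
      consider "x \<notin> W" | "x \<in> ?U" | "x \<in> e" by blast
      then show "g x = h x"
      proof cases
        case 1
        then show ?thesis using g h by (auto simp: PiE_def extensional_def)
      next
        case 3
        then show ?thesis using mono[OF g] mono[OF h] eqU[OF wU] by metis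
      qed (rule eqU)
    qed
  qed
  show "(\<lambda>g. restrict g ?U) ` ?B \<subseteq> ?C"
  proof
    fix f assume "f \<in> (\<lambda>g. restrict g ?U) ` ?B"
    then obtain g where g: "g \<in> ?B" "f = restrict g ?U" by blast
    have "card (f ` e') > 1" if e': "e' \<in> E" "e' \<subseteq> ?U" for e'
    proof -
      have sub: "e' \<subseteq> W - {v}" using e' v w by blast
      have "card (restrict g (W - {v}) ` e') > 1"
        using g e'(1) sub by (auto simp: weak_colorings_def)
      moreover have "restrict g (W - {v}) ` e' = f ` e'"
        unfolding g(2) by (rule image_cong[OF refl]) (use sub e'(2) in auto)
      ultimately show ?thesis by simp
    qed
    moreover have "f \<in> ?U \<rightarrow>\<^sub>E {1..c}" using g by (auto simp: PiE_def Pi_def)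
    ultimately show "f \<in> ?C" by (simp add: weak_colorings_def)
  qed
  show "finite ?C" using W by (simp add: finite_weak_colorings)
qed

text \<open>Coloring \<open>v\<close> arbitrarily can only spoil edges through \<open>v\<close>; the
  sum is a union bound over these.\<close>

lemma card_weak_colorings_extend:
  assumes W: "finite W" and v: "v \<in> W"
  shows "c * card (weak_colorings c E (W - {v})) \<le> card (weak_colorings c E W) +
    (\<Sum>e\<in>{e\<in>E. v \<in> e \<and> e \<subseteq> W}. card {g \<in> W \<rightarrow>\<^sub>E {1..c}.
       restrict g (W - {v}) \<in> weak_colorings c E (W - {v}) \<and> card (g ` e) \<le> 1})"
proof -
  let ?C = "weak_colorings c E (W - {v})"
  let ?I = "{e\<in>E. v \<in> e \<and> e \<subseteq> W}"
  let ?B = "\<lambda>e. {g \<in> W \<rightarrow>\<^sub>E {1..c}. restrict g (W - {v}) \<in> ?C \<and> card (g ` e) \<le> 1}"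
  have finI: "finite ?I" by (rule finite_subset[of _ "Pow W"]) (use W in auto)
  have finB: "finite (?B e)" for e
    by (rule finite_subset[of _ "W \<rightarrow>\<^sub>E {1..c}"]) (use W in \<open>auto intro: finite_PiE\<close>)
  have ext: "f v = undefined" if "f \<in> ?C" for f
    using that by (auto simp: weak_colorings_def PiE_def extensional_def)
  have inj: "inj_on (\<lambda>(f, i). f(v := i)) (?C \<times> {1..c})"
  proof (rule inj_onI, clarify)
    fix f i f' i' assume f: "f \<in> ?C" "f' \<in> ?C" and eq: "f(v := i) = f'(v := i')"
    have "f x = f' x" for x
      using fun_cong[OF eq, of x] ext[OF f(1)] ext[OF f(2)] by (cases "x = v") auto
    then show "f = f' \<and> i = i'" using fun_cong[OF eq, of v] by auto
  qed
  have img: "(\<lambda>(f, i). f(v := i)) ` (?C \<times> {1..c}) \<subseteq> weak_colorings c E W \<union> (\<Union>e\<in>?I. ?B e)"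
  proof clarify
    fix f i assume f: "f \<in> ?C" and i: "i \<in> {1..c}" and nB: "f(v := i) \<notin> (\<Union>e\<in>?I. ?B e)"
    let ?g = "f(v := i)"
    have g: "?g \<in> W \<rightarrow>\<^sub>E {1..c}"
      using f i v by (auto simp: weak_colorings_def PiE_def Pi_def extensional_def)
    have "restrict ?g (W - {v}) = f"
      using f by (auto simp: weak_colorings_def PiE_def extensional_def restrict_def fun_eq_iff)
    then have r: "restrict ?g (W - {v}) \<in> ?C" using f by simp
    have "card (?g ` e) > 1" if e: "e \<in> E" "e \<subseteq> W" for e
    proof (cases "v \<in> e")
      case True
      then show ?thesis using nB e g r by (auto simp: not_le)
    next
      case False
      then have "?g ` e = f ` e" by (intro image_cong) auto
      moreover have "e \<subseteq> W - {v}" using e False by blast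
      ultimately show ?thesis using f e(1) by (auto simp: weak_colorings_def)
    qed
    then show "?g \<in> weak_colorings c E W" using g by (simp add: weak_colorings_def)
  qed
  have "c * card ?C = card (?C \<times> {1..c})" by (simp add: card_cartesian_product)
  also have "\<dots> \<le> card (weak_colorings c E W \<union> (\<Union>e\<in>?I. ?B e))"
    using inj img by (rule card_inj_on_le) (use W finI finB in \<open>auto intro: finite_weak_colorings\<close>)
  also have "\<dots> \<le> card (weak_colorings c E W) + card (\<Union>e\<in>?I. ?B e)" by (rule card_Un_le)
  also have "card (\<Union>e\<in>?I. ?B e) \<le> (\<Sum>e\<in>?I. card (?B e))" using finI by (rule card_UN_le)
  finally show ?thesis by simp
qed

text \<open>Deleting one vertex at a time, the number of weak colorings grows by a factor at least
  \<open>\<beta>\<close> per vertex: a bad extension at \<open>v\<close> makes an edge \<open>e\<close> monochromatic, hence is determined by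
  a coloring of the complement of all but one vertex of \<open>e\<close>.\<close>

theorem weak_coloring_exists:
  fixes \<beta> :: real
  assumes hg: "uniform_hypergraph d V E" and d: "d \<ge> 2" and \<beta>: "\<beta> > 0"
    and deg: "\<And>v. v \<in> V \<Longrightarrow> real (card {e\<in>E. v \<in> e}) \<le> \<Delta>"
    and c: "\<beta> + \<Delta> / \<beta> ^ (d - 2) \<le> real c"
  shows "\<exists>\<kappa>. weak_coloring V E c \<kappa>"
proof -
  have V: "finite V" and E: "\<And>e. e \<in> E \<Longrightarrow> e \<subseteq> V \<and> card e = d"
    using hg by (auto simp: uniform_hypergraph_def)
  define P where "P = (\<lambda>W. real (card (weak_colorings c E W)))"
  have grow: "\<beta> * P (W - {v}) \<le> P W" if "W \<subseteq> V" "v \<in> W" for W v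
  proof -
    have "finite W" using that V finite_subset by blast
    then show ?thesis using that
    proof (induction W arbitrary: v rule: finite_psubset_induct)
      case (psubset W)
      let ?I = "{e\<in>E. v \<in> e \<and> e \<subseteq> W}"
      let ?B = "\<lambda>e. {g \<in> W \<rightarrow>\<^sub>E {1..c}.
        restrict g (W - {v}) \<in> weak_colorings c E (W - {v}) \<and> card (g ` e) \<le> 1}"
      have bad: "real (card (?B e)) \<le> P (W - {v}) / \<beta> ^ (d - 2)" if "e \<in> ?I" for e
      proof -
        have e: "e \<in> E" "v \<in> e" "e \<subseteq> W" "finite e" "card e = d"
          using that E psubset.hyps finite_subset by auto
        have "card (e - {v}) \<noteq> 0" using e d by simp
        then have "e - {v} \<noteq> {}" by force
        then obtain w where w: "w \<in> e" "w \<noteq> v" by blast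
        have eq: "W - (e - {w}) = W - {v} - (e - {v, w})" using e w by auto
        have "card (e - {v, w}) = d - 2" using e w by (simp add: card_Diff_subset)
        \<comment> \<open>The induction hypothesis is iterated over the d - 2 vertices of
          \<open>e\<close> other than \<open>v\<close> and \<open>w\<close>, inside
          \<open>W - {v}\<close>.\<close>
        moreover have "\<beta> ^ card (e - {v, w}) * P (W - {v} - (e - {v, w})) \<le> P (W - {v})"
        proof (rule iterate_growth)
          show "\<beta> * P (U - {u}) \<le> P U" if "U \<subseteq> W - {v}" "u \<in> U" for U u
            using psubset.IH[of U u] psubset.prems that by auto
        qed (use e \<beta> in auto)
        ultimately have "\<beta> ^ (d - 2) * P (W - (e - {w})) \<le> P (W - {v})" using eq by simp
        moreover have "real (card (?B e)) \<le> P (W - (e - {w}))"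
          unfolding P_def using card_monochromatic_extensions[OF psubset.hyps e(1,3,2) w] by simp
        ultimately have "\<beta> ^ (d - 2) * real (card (?B e)) \<le> P (W - {v})"
          using \<beta> by (meson mult_left_mono order_trans zero_le_power less_imp_le)
        then show ?thesis using \<beta> by (simp add: pos_le_divide_eq mult.commute)
      qed
      have "real c * P (W - {v}) \<le> P W + (\<Sum>e\<in>?I. real (card (?B e)))"
        unfolding P_def using card_weak_colorings_extend[OF psubset.hyps psubset.prems(2), of c E]
        by (simp only: flip: of_nat_add of_nat_le_iff[where 'a = real] of_nat_mult of_nat_sum)
      also have "(\<Sum>e\<in>?I. real (card (?B e))) \<le> real (card ?I) * (P (W - {v}) / \<beta> ^ (d - 2))"
        using sum_bounded_above[of ?I "\<lambda>e. real (card (?B e))", OF bad] by simp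
      also have "\<dots> \<le> \<Delta> * (P (W - {v}) / \<beta> ^ (d - 2))"
      proof (rule mult_right_mono)
        have "finite {e\<in>E. v \<in> e}"
          by (rule finite_subset[of _ "Pow V"]) (use E V in auto)
        then have "card ?I \<le> card {e\<in>E. v \<in> e}" by (intro card_mono) auto
        then show "real (card ?I) \<le> \<Delta>" using deg[of v] psubset.prems by force
      qed (use \<beta> in \<open>simp add: P_def\<close>)
      finally have 1: "real c * P (W - {v}) \<le> P W + \<Delta> / \<beta> ^ (d - 2) * P (W - {v})" by simp
      have "(\<beta> + \<Delta> / \<beta> ^ (d - 2)) * P (W - {v}) \<le> real c * P (W - {v})"
        using c by (intro mult_right_mono) (auto simp: P_def)
      with 1 show ?case by (simp add: algebra_simps)
    qed
  qed
  have "\<beta> ^ card V * P (V - V) \<le> P V"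
    using V \<beta> grow by (intro iterate_growth) auto
  \<comment> \<open>Only an empty edge could constrain the empty coloring, and edges have at least
    two vertices.\<close>
  moreover have "P {} = 1"
  proof -
    have "weak_colorings c E {} = {\<lambda>_. undefined}"
      using E[of "{}"] d by (auto simp: weak_colorings_def)
    then show ?thesis by (simp add: P_def)
  qed
  moreover have "\<beta> ^ card V > 0" using \<beta> by simp
  ultimately have "P V \<noteq> 0" by (auto simp: not_less)
  then obtain f where "f \<in> weak_colorings c E V" unfolding P_def by fastforce
  then have "weak_coloring V E c f"
    using E by (auto simp: weak_colorings_def weak_coloring_def PiE_def Pi_def)
  then show ?thesis by blast
qed

section \<open>Complete partite hypergraphs do not embed\<close>

text \<open>A common point lies in the hull of the shared vertices. Within each of the two affinely
  independent simplices hulls intersect as their vertex sets do, so \<open>A\<close> and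
  \<open>B\<close> may be cut down to their shared vertices. These are disjoint faces of the single
  simplex on \<open>e1\<close>.\<close>

lemma disjoint_faces:
  fixes \<phi> :: "'v \<Rightarrow> 'c::euclidean_space"
  assumes hg: "uniform_hypergraph d V E" and emb: "lin_embedding d V E \<phi>"
    and e: "e1 \<in> E" "e2 \<in> E" and A: "A \<subseteq> e1" and B: "B \<subseteq> e2" and AB: "A \<inter> B = {}"
  shows "convex hull (\<phi> ` A) \<inter> convex hull (\<phi> ` B) = {}"
proof -
  have indep: "\<not> affine_dependent (\<phi> ` f)" "inj_on \<phi> f" if "f \<in> E" for f
  proof -
    have f: "finite f" "card f = d"
      using hg that finite_subset by (auto simp: uniform_hypergraph_def)
    have dim: "aff_dim (\<phi> ` f) = int d - 1" using emb that by (simp add: lin_embedding_def)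
    have "card (\<phi> ` f) = d"
      using aff_dim_le_card[of "\<phi> ` f"] card_image_le[OF f(1), of \<phi>] f dim by simp
    then show "\<not> affine_dependent (\<phi> ` f)" "inj_on \<phi> f"
      using f dim by (simp_all add: affine_independent_iff_card eq_card_imp_inj_on)
  qed
  have face: "convex hull (\<phi> ` S) \<inter> convex hull (\<phi> ` T) = convex hull (\<phi> ` (S \<inter> T))"
    if "f \<in> E" "S \<subseteq> f" "T \<subseteq> f" for f S T
  proof -
    have "\<not> affine_dependent (\<phi> ` S \<union> \<phi> ` T)"
      using indep(1)[OF that(1)] that(2,3) affine_independent_subset[of "\<phi> ` f" "\<phi> ` S \<union> \<phi> ` T"] by blast
    then have "convex hull (\<phi> ` S) \<inter> convex hull (\<phi> ` T) = convex hull (\<phi> ` S \<inter> \<phi> ` T)"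
      by (rule convex_hull_Int[symmetric])
    also have "\<phi> ` S \<inter> \<phi> ` T = \<phi> ` (S \<inter> T)"
      using inj_on_image_Int[OF indep(2)[OF that(1)] that(2,3)] by simp
    finally show ?thesis .
  qed
  let ?C = "e1 \<inter> e2"
  have "x \<notin> convex hull (\<phi> ` A) \<inter> convex hull (\<phi> ` B)" for x
  proof
    assume x: "x \<in> convex hull (\<phi> ` A) \<inter> convex hull (\<phi> ` B)"
    have "convex hull (\<phi> ` A) \<subseteq> convex hull (\<phi> ` e1)" "convex hull (\<phi> ` B) \<subseteq> convex hull (\<phi> ` e2)"
      using A B by (auto intro!: hull_mono)
    then have "x \<in> convex hull (\<phi> ` e1) \<inter> convex hull (\<phi> ` e2)" using x by blast
    moreover have "convex hull (\<phi> ` e1) \<inter> convex hull (\<phi> ` e2) = convex hull (\<phi> ` ?C)"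
      using emb e unfolding lin_embedding_def by blast
    ultimately have xC: "x \<in> convex hull (\<phi> ` ?C)" by simp
    have "x \<in> convex hull (\<phi> ` (A \<inter> ?C))"
      using face[OF e(1) A, of ?C] x xC by blast
    moreover have "x \<in> convex hull (\<phi> ` (B \<inter> ?C))"
      using face[OF e(2) B, of ?C] x xC by blast
    ultimately have "x \<in> convex hull (\<phi> ` (A \<inter> ?C \<inter> (B \<inter> ?C)))"
      using face[OF e(1), of "A \<inter> ?C" "B \<inter> ?C"] by blast
    moreover have "A \<inter> ?C \<inter> (B \<inter> ?C) = {}" using AB by blast
    ultimately show False by simp
  qed
  then show ?thesis by blast
qed

text \<open>The supports of \<open>U _ x\<close> and \<open>U _ (- x)\<close> describe a point of the deleted join. Scaling by the total
  weight \<open>S\<close> makes \<open>S x *\<^sub>R \<psi> (pt x)\<close> continuous also where \<open>S x = 0\<close>.\<close>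

lemma deleted_join_obstruction:
  fixes U :: "'i \<Rightarrow> 'x::euclidean_space \<Rightarrow> real" and vt :: "'i \<Rightarrow> 'v"
    and \<phi> :: "'v \<Rightarrow> 'c::euclidean_space" and \<psi> :: "'c \<Rightarrow> 'a::euclidean_space"
  assumes dim: "DIM('x) = DIM('a) + 2"
    and hg: "uniform_hypergraph d V E" and emb: "lin_embedding d V E \<phi>"
    and \<psi>: "continuous_on (hg_image E \<phi>) \<psi>" "inj_on \<psi> (hg_image E \<phi>)"
    and I: "finite I" "inj_on vt I"
    and U: "\<And>i. i \<in> I \<Longrightarrow> continuous_on UNIV (U i)" "\<And>i x. i \<in> I \<Longrightarrow> 0 \<le> U i x"
    and supp: "\<And>x. \<exists>e\<in>E. vt ` {i\<in>I. U i x \<noteq> 0} \<subseteq> e"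
    and disj: "\<And>i x. i \<in> I \<Longrightarrow> U i x \<noteq> 0 \<Longrightarrow> U i (- x) = 0"
    and nz: "\<And>x. x \<noteq> 0 \<Longrightarrow> \<exists>i\<in>I. U i x \<noteq> 0 \<or> U i (- x) \<noteq> 0"
  shows False
proof -
  define J where "J = (\<lambda>x. {i\<in>I. U i x \<noteq> 0})"
  define S where "S = (\<lambda>x. \<Sum>i\<in>I. U i x)"
  define pt where "pt = (\<lambda>x. (1 / S x) *\<^sub>R (\<Sum>i\<in>I. U i x *\<^sub>R \<phi> (vt i)))"
  define K where "K = hg_image E \<phi>"
  have finE: "finite E" and fine: "\<And>e. e \<in> E \<Longrightarrow> finite e"
  proof -
    have V: "finite V" and E: "\<And>e. e \<in> E \<Longrightarrow> e \<subseteq> V" using hg by (auto simp: uniform_hypergraph_def)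
    show "finite E" by (rule finite_subset[of _ "Pow V"]) (use V E in auto)
    show "finite e" if "e \<in> E" for e using finite_subset[OF E[OF that] V] .
  qed
  have S0: "S x \<ge> 0" for x unfolding S_def using U(2) by (intro sum_nonneg)
  have contS: "continuous_on UNIV S" unfolding S_def using U(1) by (intro continuous_on_sum)
  have pt_hull: "pt x \<in> convex hull (\<phi> ` vt ` J x)" if "S x > 0" for x
  proof -
    have JI: "J x \<subseteq> I" by (auto simp: J_def)
    have "S x = (\<Sum>i\<in>J x. U i x)"
      unfolding S_def by (rule sum.mono_neutral_right) (use I JI in \<open>auto simp: J_def\<close>)
    then have one: "(\<Sum>i\<in>J x. U i x / S x) = 1" using that by (simp flip: sum_divide_distrib)
    have "(\<Sum>i\<in>I. U i x *\<^sub>R \<phi> (vt i)) = (\<Sum>i\<in>J x. U i x *\<^sub>R \<phi> (vt i))"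
      by (rule sum.mono_neutral_right) (use I JI in \<open>auto simp: J_def\<close>)
    then have "pt x = (1 / S x) *\<^sub>R (\<Sum>i\<in>J x. U i x *\<^sub>R \<phi> (vt i))" by (simp only: pt_def)
    also have "\<dots> = (\<Sum>i\<in>J x. (U i x / S x) *\<^sub>R \<phi> (vt i))" by (simp add: scaleR_sum_right)
    also have "\<dots> \<in> convex hull (\<phi> ` vt ` J x)"
      using I JI U(2) S0 one finite_subset by (intro convex_sum) (auto intro!: hull_inc divide_nonneg_nonneg)
    finally show ?thesis .
  qed
  have pt_K: "pt x \<in> K" if "S x > 0" for x
  proof -
    obtain e where e: "e \<in> E" "vt ` J x \<subseteq> e" using supp[of x] unfolding J_def by blast
    then have "convex hull (\<phi> ` vt ` J x) \<subseteq> convex hull (\<phi> ` e)" by (intro hull_mono image_mono)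
    then show ?thesis using pt_hull[OF that] e(1) unfolding K_def hg_image_def by blast
  qed
  have "compact K" unfolding K_def hg_image_def
    using finE fine by (intro compact_UN compact_convex_hull finite_imp_compact finite_imageI) auto
  then have "bounded (\<psi> ` K)"
    using \<psi>(1) unfolding K_def by (intro compact_imp_bounded compact_continuous_image)
  then obtain M where M: "\<And>z. z \<in> K \<Longrightarrow> norm (\<psi> z) \<le> M" unfolding bounded_iff by blast
  define G where "G = (\<lambda>x. S x *\<^sub>R \<psi> (pt x))"
  have contG: "continuous_on UNIV G"
  proof -
    have "isCont G x" for x
    proof (cases "S x > 0")
      case True
      let ?P = "{x. S x > 0}"
      have "open ?P" by (rule open_Collect_less[OF continuous_on_const contS])
      moreover have "continuous_on ?P G"
      proof -
        have "continuous_on ?P S" using contS continuous_on_subset by blast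
        moreover have "continuous_on ?P (\<lambda>x. \<Sum>i\<in>I. U i x *\<^sub>R \<phi> (vt i))"
          using U(1) by (intro continuous_on_sum continuous_on_scaleR continuous_on_const) (auto intro: continuous_on_subset)
        ultimately have "continuous_on ?P pt" unfolding pt_def
          by (intro continuous_on_scaleR continuous_on_divide continuous_on_const) auto
        moreover have "pt ` ?P \<subseteq> K" using pt_K by auto
        ultimately have "continuous_on ?P (\<lambda>x. \<psi> (pt x))"
          using continuous_on_compose2[OF \<psi>(1)] unfolding K_def by blast
        then show ?thesis unfolding G_def using \<open>continuous_on ?P S\<close> by (intro continuous_on_scaleR)
      qed
      ultimately show ?thesis using True continuous_on_eq_continuous_at by blast
    next
      case False
      then have Sx: "S x = 0" using S0[of x] by simp
      have "(S \<longlongrightarrow> S x) (at x)" using contS by (simp add: continuous_on_def)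
      then have "((\<lambda>y. S y * M) \<longlongrightarrow> 0 * M) (at x)" unfolding Sx by (intro tendsto_mult tendsto_const)
      \<comment> \<open>\<open>\<psi>\<close> is bounded on the compact image, so \<open>G\<close>
        tends to 0 together with the weight \<open>S\<close>.\<close>
      moreover have "norm (G y) \<le> S y * M" for y
      proof (cases "S y > 0")
        case True
        then show ?thesis using M[OF pt_K[OF True]] by (simp add: G_def)
      next
        case False
        then show ?thesis using S0[of y] by (simp add: G_def)
      qed
      ultimately have "(G \<longlongrightarrow> 0) (at x)"
        using Lim_null_comparison[of G "\<lambda>y. S y * M" "at x"] by simp
      then show ?thesis using Sx by (simp add: isCont_def G_def)
    qed
    then show ?thesis by (simp add: continuous_at_imp_continuous_on)
  qed
  \<comment> \<open>The second component forces equal total weights at x and -x, so that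
    \<open>S\<close> cancels from \<open>G x = G (- x)\<close>; it accounts for one of the two extra
    dimensions, the other being the one Borsuk-Ulam asks for.\<close>
  define F where "F = (\<lambda>x. (G x - G (- x), S x - S (- x)))"
  have neg: "continuous_on UNIV (\<lambda>x. H (- x))" if "continuous_on UNIV H" for H :: "'x \<Rightarrow> 'z::topological_space"
    using continuous_on_compose2[OF that continuous_on_minus[OF continuous_on_id]] by simp
  have "continuous_on UNIV F"
    unfolding F_def using contG contS neg[OF contG] neg[OF contS] by (intro continuous_intros)
  moreover have "DIM('x) = Suc (DIM('a \<times> real))" using dim by simp
  moreover have "F (- x) = - F x" for x by (simp add: F_def)
  ultimately obtain x where x: "x \<noteq> 0" "F x = 0"
    using borsuk_ulam_odd_zero[of F] by blast
  have eq: "S (- x) = S x" "G (- x) = G x" using x(2) by (simp_all add: F_def zero_prod_def)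
  have "S x > 0"
  proof -
    obtain i where i: "i \<in> I" "U i x \<noteq> 0 \<or> U i (- x) \<noteq> 0" using nz[OF x(1)] by blast
    have "U i x \<le> S x" "U i (- x) \<le> S (- x)"
      unfolding S_def using i(1) I(1) U(2) by (auto intro!: member_le_sum)
    then show ?thesis using i U(2)[OF i(1), of x] U(2)[OF i(1), of "- x"] eq(1) by linarith
  qed
  then have "\<psi> (pt (- x)) = \<psi> (pt x)" using eq by (simp add: G_def)
  then have pteq: "pt (- x) = pt x"
    using \<psi>(2) pt_K \<open>S x > 0\<close> eq(1) unfolding K_def by (metis inj_onD)
  obtain e1 where e1: "e1 \<in> E" "vt ` J x \<subseteq> e1" using supp[of x] unfolding J_def by blast
  obtain e2 where e2: "e2 \<in> E" "vt ` J (- x) \<subseteq> e2" using supp[of "- x"] unfolding J_def by blast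
  have "vt ` J x \<inter> vt ` J (- x) = {}"
    using I(2) disj by (auto simp: J_def dest: inj_onD)
  then have "convex hull (\<phi> ` vt ` J x) \<inter> convex hull (\<phi> ` vt ` J (- x)) = {}"
    using disjoint_faces[OF hg emb e1(1) e2(1) e1(2) e2(2)] by blast
  then show False
    using pt_hull[OF \<open>S x > 0\<close>] pt_hull[of "- x"] \<open>S x > 0\<close> eq(1) pteq by auto
qed

text \<open>Among the values \<open>a, b, 0\<close> attached to the three vertices of a part, the weight is the excess of the
  strict maximum over the others. At \<open>(- a, - b)\<close> it sits at the strict minimum instead, so the plane
  is identified with the cone over the hexagon that is the deleted join of three points.\<close>

definition hexagon_weight :: "nat \<Rightarrow> real \<Rightarrow> real \<Rightarrow> real" where
  "hexagon_weight t a b =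
    (if t = 0 then max 0 (a - max b 0) else if t = 1 then max 0 (b - max a 0) else max 0 (- max a b))"

lemma hexagon_weight_nonneg: "0 \<le> hexagon_weight t a b"
  by (simp add: hexagon_weight_def)

lemma hexagon_weight_nonzero_iff:
  "hexagon_weight t a b \<noteq> 0 \<longleftrightarrow>
    (if t = 0 then a > b \<and> a > 0 else if t = 1 then b > a \<and> b > 0 else a < 0 \<and> b < 0)"
  by (simp add: hexagon_weight_def max_def)

lemma hexagon_weight_disjoint: "hexagon_weight t a b \<noteq> 0 \<Longrightarrow> hexagon_weight t (- a) (- b) = 0"
  using hexagon_weight_nonzero_iff[of t a b] hexagon_weight_nonzero_iff[of t "- a" "- b"]
  by (cases "t = 0"; cases "t = 1") auto

text \<open>A maximum that is strict is attained once; hence a support meets each part in at most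
  one vertex and extends to an edge.\<close>

lemma hexagon_weight_unique:
  assumes "hexagon_weight t a b \<noteq> 0" "hexagon_weight t' a b \<noteq> 0" "t < 3" "t' < 3"
  shows "t = t'"
proof -
  have "t = 0 \<or> t = 1 \<or> t = 2" "t' = 0 \<or> t' = 1 \<or> t' = 2" using assms(3,4) by linarith+
  then show ?thesis using assms(1,2) unfolding hexagon_weight_nonzero_iff by (elim disjE) simp_all
qed

text \<open>Three values \<open>a\<close>, \<open>b\<close>, 0 that are not all equal have a unique
  maximum or a unique minimum.\<close>

lemma hexagon_weight_nonzero:
  assumes "a \<noteq> 0 \<or> b \<noteq> 0"
  shows "\<exists>t<3. hexagon_weight t a b \<noteq> 0 \<or> hexagon_weight t (- a) (- b) \<noteq> 0"
proof -
  consider "a > b \<and> a > 0" | "b > a \<and> b > 0" | "a < 0 \<and> b < 0" | "- a > - b \<and> - a > 0"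
    | "- b > - a \<and> - b > 0" | "- a < 0 \<and> - b < 0"
    using assms by linarith
  then show ?thesis
    unfolding hexagon_weight_nonzero_iff
    by cases (rule exI[of _ 0] exI[of _ 1] exI[of _ 2], simp; fail)+
qed

lemma listset_list_all2: "listset As = {xs. list_all2 (\<in>) xs As}"
proof (induction As)
  case (Cons A As)
  then show ?case by (auto simp: set_Cons_def list_all2_Cons2)
qed simp

text \<open>The type \<open>'a \<times> real \<times> real\<close> supplies a space of dimension 2m
  + \<open>length zs\<close>: a plane for each part of size 3 and a line for each vertex of
  \<open>zs\<close>, whose weight is positive on one side of the line.\<close>

theorem no_box_of_embedding:
  fixes \<phi> :: "'v \<Rightarrow> 'c::euclidean_space" and \<psi> :: "'c \<Rightarrow> 'a::euclidean_space"
  assumes dim: "DIM('a) + 2 = 2 * m + length zs"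
    and hg: "uniform_hypergraph d V E" and emb: "lin_embedding d V E \<phi>"
    and \<psi>: "continuous_on (hg_image E \<phi>) \<psi>" "inj_on \<psi> (hg_image E \<phi>)"
  shows "\<not> has_box V m {ys. distinct (zs @ ys) \<and> set (zs @ ys) \<in> E}"
proof
  assume "has_box V m {ys. distinct (zs @ ys) \<and> set (zs @ ys) \<in> E}"
  then obtain As where As: "length As = m" "\<And>A. A \<in> set As \<Longrightarrow> card A = 3"
    and box: "listset As \<subseteq> {ys. distinct (zs @ ys) \<and> set (zs @ ys) \<in> E}"
    unfolding has_box_def by blast
  define j where "j = length zs"
  have "\<exists>f. As ! i = f ` {..<3::nat} \<and> inj_on f {..<3}" if "i < m" for i
  proof -
    have "card (As ! i) = 3" using As that by simp
    then have "finite (As ! i)" by (metis card.infinite zero_neq_numeral)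
    then obtain f where "bij_betw f {0..<3::nat} (As ! i)"
      using ex_bij_betw_nat_finite \<open>card (As ! i) = 3\<close> by metis
    then show ?thesis unfolding atLeast0LessThan bij_betw_def by metis
  qed
  then obtain A where A: "\<And>i. i < m \<Longrightarrow> As ! i = A i ` {..<3::nat}" "\<And>i. i < m \<Longrightarrow> inj_on (A i) {..<3}"
    by metis
  have edge: "distinct (zs @ map (\<lambda>i. A i (t i)) [0..<m]) \<and> set (zs @ map (\<lambda>i. A i (t i)) [0..<m]) \<in> E"
    if "\<And>i. t i < 3" for t
  proof -
    have "map (\<lambda>i. A i (t i)) [0..<m] \<in> listset As"
      unfolding listset_list_all2 list_all2_conv_all_nth using As(1) A(1) that by auto
    then show ?thesis using box by blast
  qed
  obtain b where b: "bij_betw b {0..<2 * m + j} (Basis :: ('a \<times> real \<times> real) set)"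
    using ex_bij_betw_nat_finite[of "Basis :: ('a \<times> real \<times> real) set"] dim by (auto simp: j_def)
  define X where "X = (\<lambda>k (x::'a \<times> real \<times> real). x \<bullet> b k)"
  have X: "X k (- x) = - X k x" "continuous_on UNIV (X k)" for k x
    by (auto simp: X_def intro: continuous_intros)
  \<comment> \<open>Part \<open>i < m\<close> reads the coordinates 2i and 2i + 1; the single
    vertices have indices from \<open>m\<close> on, so m + i runs through the coordinates from 2m
    on.\<close>
  define U where "U = (\<lambda>(i, t) x. if i < m then hexagon_weight t (X (2 * i) x) (X (2 * i + 1) x)
                                  else max 0 (X (m + i) x))"
  define vt where "vt = (\<lambda>(i, t). if i < m then A i t else zs ! (i - m))"
  define I where "I = {..<m} \<times> {..<3::nat} \<union> {m..<m + j} \<times> {0}"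
  show False
  proof (rule deleted_join_obstruction[where U = U and vt = vt and I = I, OF _ hg emb \<psi>])
    show "DIM('a \<times> real \<times> real) = DIM('a) + 2" by simp
    show "finite I" by (simp add: I_def)
    show "continuous_on UNIV (U i)" if "i \<in> I" for i
    proof (cases i)
      case (Pair i t)
      then show ?thesis
        unfolding U_def hexagon_weight_def using X(2)
        by (cases "i < m"; cases "t = 0"; cases "t = 1") (auto intro!: continuous_intros)
    qed
    show "0 \<le> U i x" for i x by (cases i) (simp add: U_def hexagon_weight_nonneg)
    show "U i (- x) = 0" if "U i x \<noteq> 0" for i x
      using that by (cases i) (auto simp: U_def X(1) hexagon_weight_disjoint split: if_splits)
    show "inj_on vt I"
    proof (rule inj_onI)
      fix p q assume p: "p \<in> I" and q: "q \<in> I" and eq: "vt p = vt q"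
      obtain i t i' t' where pq: "p = (i, t)" "q = (i', t')" by fastforce
      \<comment> \<open>A transversal through both points if they lie in different parts; the
        corresponding edge is a distinct list, which separates them.\<close>
      define \<tau> where "\<tau> = (\<lambda>k::nat. 0::nat)(i := t, i' := (if i = i' then t else t'))"
      have t3: "t < 3" "t' < 3" using p q by (auto simp: pq I_def)
      then have "\<tau> k < 3" for k by (simp add: \<tau>_def)
      then have D: "distinct (zs @ map (\<lambda>k. A k (\<tau> k)) [0..<m])" using edge by blast
      define L where "L = zs @ map (\<lambda>k. A k (\<tau> k)) [0..<m]"
      define pos where "pos = (\<lambda>k. if k < m then j + k else k - m)"
      have L: "vt (k, \<tau> k) = L ! pos k \<and> pos k < length L" if "k < m + j" for k
        using that by (auto simp: vt_def L_def pos_def j_def nth_append)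
      have ij: "i < m + j" "i' < m + j" using p q by (auto simp: pq I_def)
      show "p = q"
      proof (cases "i = i'")
        case True
        then show ?thesis
          using eq p q t3 A(2) by (cases "i < m") (auto simp: pq vt_def I_def dest: inj_onD)
      next
        case False
        then have "\<tau> i = t" "\<tau> i' = t'" by (simp_all add: \<tau>_def)
        then have "L ! pos i = L ! pos i'" using L ij eq by (metis pq)
        then have "pos i = pos i'" using D L ij unfolding L_def by (simp add: nth_eq_iff_index_eq)
        then show ?thesis using False ij by (auto simp: pos_def split: if_splits)
      qed
    qed
    show "\<exists>e\<in>E. vt ` {i \<in> I. U i x \<noteq> 0} \<subseteq> e" for x
    proof -
      \<comment> \<open>The vertex of part \<open>i\<close> with nonzero weight if there is one,
        otherwise an arbitrary vertex that completes the support to an edge.\<close>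
      define t where "t = (\<lambda>i. if \<exists>s<3. U (i, s) x \<noteq> 0 then SOME s. s < 3 \<and> U (i, s) x \<noteq> 0 else 0)"
      have tS: "t i < 3 \<and> (\<forall>s<3. i < m \<longrightarrow> U (i, s) x \<noteq> 0 \<longrightarrow> t i = s)" for i
      proof (cases "\<exists>s<3. U (i, s) x \<noteq> 0")
        case True
        then have "t i < 3 \<and> U (i, t i) x \<noteq> 0"
          unfolding t_def by (simp only: if_True) (rule someI_ex)
        then show ?thesis using hexagon_weight_unique by (auto simp: U_def)
      next
        case False
        then show ?thesis by (auto simp: t_def)
      qed
      let ?e = "set (zs @ map (\<lambda>i. A i (t i)) [0..<m])"
      have "vt p \<in> ?e" if "p \<in> I" "U p x \<noteq> 0" for p
      proof (cases p)
        case (Pair i s)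
        show ?thesis
        proof (cases "i < m")
          case True
          then have "t i = s" using tS[of i] that Pair by (auto simp: I_def)
          then show ?thesis using True Pair by (auto simp: vt_def)
        next
          case False
          then show ?thesis using that(1) Pair by (auto simp: vt_def I_def j_def)
        qed
      qed
      moreover have "?e \<in> E" using edge[of t] tS by blast
      ultimately show ?thesis by blast
    qed
    show "\<exists>i\<in>I. U i x \<noteq> 0 \<or> U i (- x) \<noteq> 0" if "x \<noteq> 0" for x
    proof -
      obtain c where "c \<in> Basis" "x \<bullet> c \<noteq> 0" using \<open>x \<noteq> 0\<close> euclidean_all_zero_iff by blast
      then obtain k where k: "k < 2 * m + j" "X k x \<noteq> 0"
        using b by (auto simp: bij_betw_def X_def image_iff) (metis atLeastLessThan_iff imageE)
      show ?thesis
      proof (cases "k < 2 * m")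
        case True
        define i where "i = k div 2"
        have i: "i < m" "k = 2 * i \<or> k = 2 * i + 1" using True by (auto simp: i_def)
        then have "X (2 * i) x \<noteq> 0 \<or> X (2 * i + 1) x \<noteq> 0" using k by auto
        then obtain s where "s < 3" "U (i, s) x \<noteq> 0 \<or> U (i, s) (- x) \<noteq> 0"
          using hexagon_weight_nonzero i(1) by (auto simp: U_def X(1))
        moreover have "(i, s) \<in> I" using i(1) \<open>s < 3\<close> by (simp add: I_def)
        ultimately show ?thesis by blast
      next
        case False
        then have "(k - m, 0) \<in> I" using k(1) by (auto simp: I_def)
        moreover have "U (k - m, 0) x \<noteq> 0 \<or> U (k - m, 0) (- x) \<noteq> 0"
          using False k by (auto simp: U_def X(1) max_def)
        ultimately show ?thesis by blast
      qed
    qed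
  qed
qed

section \<open>The chromatic bound\<close>

lemma degree_le:
  fixes \<phi> :: "'v \<Rightarrow> 'c::euclidean_space" and \<psi> :: "'c \<Rightarrow> 'a::euclidean_space"
  assumes l: "3 \<le> l" "l \<le> d" and hg: "uniform_hypergraph d V E"
    and dim: "DIM('a) = 2 * d - l" and emb: "lin_embedding d V E \<phi>"
    and \<psi>: "continuous_on (hg_image E \<phi>) \<psi>" "inj_on \<psi> (hg_image E \<phi>)"
  shows "real (card {e\<in>E. v \<in> e}) \<le> real (card V) powr (real (d - 1) - 3 powr (real l - 1 - real d))"
proof -
  define F where "F = (\<lambda>e. e - {v}) ` {e\<in>E. v \<in> e}"
  \<comment> \<open>The \<open>a\<close> prefix vertices together with \<open>v\<close> are the l -
    2 parts of size 1, and 2m + (l - 2) = (2d - l) + 2 as \<open>no_box_of_embedding\<close>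
    demands.\<close>
  define m where "m = d - l + 2"
  define a where "a = l - 3"
  have am: "a + m = d - 1" using l by (simp add: a_def m_def)
  have V: "finite V" and E: "\<And>e. e \<in> E \<Longrightarrow> e \<subseteq> V \<and> card e = d"
    using hg by (auto simp: uniform_hypergraph_def)
  have "inj_on (\<lambda>e. e - {v}) {e\<in>E. v \<in> e}" by (rule inj_onI) blast
  then have cF: "card F = card {e\<in>E. v \<in> e}" by (simp add: F_def card_image)
  have "real (card F) \<le> real (card V) powr (real (a + m) - 3 powr (1 - real m))"
  proof (rule card_le_of_no_box[OF V])
    show "e \<subseteq> V \<and> card e = a + m" if "e \<in> F" for e
      using that E am unfolding F_def by (auto simp: card_Diff_singleton)
    show "m \<ge> 1" "a + m \<ge> 2" using l by (simp_all add: m_def)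
    fix zs :: "'v list" assume zs: "length zs = a"
    have sub: "{ys. distinct (zs @ ys) \<and> set (zs @ ys) \<in> F \<and> length ys = m}
      \<subseteq> {ys. distinct ((v # zs) @ ys) \<and> set ((v # zs) @ ys) \<in> E}"
    proof
      fix ys assume ys: "ys \<in> {ys. distinct (zs @ ys) \<and> set (zs @ ys) \<in> F \<and> length ys = m}"
      then obtain e where e: "e \<in> E" "v \<in> e" "set (zs @ ys) = e - {v}" unfolding F_def by blast
      then have "insert v (set (zs @ ys)) = e" "v \<notin> set (zs @ ys)" by blast+
      then show "ys \<in> {ys. distinct ((v # zs) @ ys) \<and> set ((v # zs) @ ys) \<in> E}"
        using ys e(1) by simp
    qed
    have "\<not> has_box V m {ys. distinct ((v # zs) @ ys) \<and> set ((v # zs) @ ys) \<in> E}"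
    proof (rule no_box_of_embedding[OF _ hg emb \<psi>])
      show "DIM('a) + 2 = 2 * m + length (v # zs)"
        using dim zs l by (simp add: m_def a_def)
    qed
    then show "\<not> has_box V m {ys. distinct (zs @ ys) \<and> set (zs @ ys) \<in> F \<and> length ys = m}"
      by (rule contrapos_nn) (rule has_box_mono[OF _ sub])
  qed
  moreover have "1 - real m = real l - 1 - real d" using l by (simp add: m_def of_nat_diff)
  ultimately show ?thesis by (simp add: cF am)
qed

text \<open>The source of Euler's number in the final bound.\<close>

lemma one_plus_inverse_power_le_exp:
  assumes "k \<ge> 1" shows "((real k + 1) / real k) ^ k \<le> exp 1"
proof -
  have "(real k + 1) / real k = 1 + 1 / real k" using assms by (simp add: field_simps)
  also have "\<dots> ^ k \<le> exp (1 / real k) ^ k" by (intro power_mono exp_ge_add_one_self) simp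
  also have "\<dots> = exp 1" using assms by (simp flip: exp_of_nat_mult)
  finally show ?thesis .
qed

text \<open>This \<open>\<beta>\<close> maximises \<beta>^k (X - \<beta>), with maximum X^(k+1) /
  ((k + 1) q) for q = (1 + 1/k)^k <= e. That \<open>D\<close> is at most this value follows from the
  assumption, where k + 2 will be the uniformity d.\<close>

lemma color_count_estimate:
  fixes D X :: real
  assumes k: "k \<ge> 1" and X: "X > 0" and D: "D \<ge> 0" and le: "exp 1 * (real k + 2) * D \<le> X ^ Suc k"
  defines "\<beta> \<equiv> X * real k / (real k + 1)"
  shows "\<beta> + D / \<beta> ^ k \<le> X"
proof -
  define q where "q = ((real k + 1) / real k) ^ k"
  have q: "q \<le> exp 1" "q > 0" using one_plus_inverse_power_le_exp[OF k] k by (simp_all add: q_def)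
  have "\<beta> = X / ((real k + 1) / real k)" using k by (simp add: \<beta>_def)
  then have \<beta>: "\<beta> ^ k = X ^ k / q" by (simp only: q_def power_divide)
  have "(real k + 1) * D * q \<le> (real k + 2) * D * exp 1"
    using D q by (intro mult_mono) auto
  also have "\<dots> \<le> X * X ^ k" using le by (simp add: mult_ac)
  finally have "D * q / X ^ k \<le> X / (real k + 1)"
    using X k by (simp add: field_simps)
  then have "D / \<beta> ^ k \<le> X / (real k + 1)" by (simp add: \<beta>)
  moreover have "\<beta> + X / (real k + 1) = X"
    using k by (simp add: \<beta>_def add_divide_distrib[symmetric] field_simps)
  ultimately show ?thesis by linarith
qed

lemma weak_chi_le_of_embedding:
  fixes \<phi> :: "'v \<Rightarrow> 'c::euclidean_space" and \<psi> :: "'c \<Rightarrow> 'a::euclidean_space"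
  assumes l: "3 \<le> l" "l \<le> d" and hg: "uniform_hypergraph d V E" and n: "card V = n"
    and dim: "DIM('a) = 2 * d - l" and emb: "lin_embedding d V E \<phi>"
    and \<psi>: "continuous_on (hg_image E \<phi>) \<psi>" "inj_on \<psi> (hg_image E \<phi>)"
  shows "int (weak_chi V E) \<le>
    \<lceil>(exp 1 * real d) powr (1 / (real d - 1)) *
      real n powr (1 - 3 powr (real l - 1 - real d) / (real d - 1))\<rceil>"
proof -
  define \<epsilon> where "\<epsilon> = 3 powr (real l - 1 - real d)"
  \<comment> \<open>Chosen so that X^(d-1) is e d times the degree bound of
    \<open>degree_le\<close>.\<close>
  define X where "X = (exp 1 * real d) powr (1 / (real d - 1)) * real n powr (1 - \<epsilon> / (real d - 1))"
  have "\<exists>\<kappa>. weak_coloring V E (nat \<lceil>X\<rceil>) \<kappa>"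
  \<comment> \<open>For n = 0 the bound is 0, as \<open>powr\<close> with base 0 is 0; there are no
    vertices or edges, and zero colors suffice.\<close>
  proof (cases "n = 0")
    case True
    then have "V = {}" using hg n by (simp add: uniform_hypergraph_def)
    moreover have "E = {}"
      using \<open>V = {}\<close> hg l by (fastforce simp: uniform_hypergraph_def)
    ultimately show ?thesis by (simp add: weak_coloring_def)
  next
    case False
    define k where "k = d - 2"
    have k: "k \<ge> 1" "d = k + 2" using l by (auto simp: k_def)
    have X: "X > 0" using False k by (simp add: X_def)
    define \<Delta> where "\<Delta> = real n powr (real (d - 1) - \<epsilon>)"
    have "X ^ Suc k = (exp 1 * real d) powr (1 / (real d - 1) * real (Suc k)) *
        real n powr ((1 - \<epsilon> / (real d - 1)) * real (Suc k))"
      using False k unfolding X_def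
      by (simp add: power_mult_distrib powr_power mult.commute del: power_Suc of_nat_Suc)
    also have "1 / (real d - 1) * real (Suc k) = 1" using k by (simp add: field_simps)
    also have "(1 - \<epsilon> / (real d - 1)) * real (Suc k) = real (d - 1) - \<epsilon>" using k by (simp add: field_simps)
    finally have "exp 1 * (real k + 2) * \<Delta> \<le> X ^ Suc k" using k by (simp add: \<Delta>_def add.commute)
    then have "X * real k / (real k + 1) + \<Delta> / (X * real k / (real k + 1)) ^ k \<le> X"
      using k X by (intro color_count_estimate) (simp_all add: \<Delta>_def)
    also have "\<dots> \<le> real (nat \<lceil>X\<rceil>)" by (rule real_nat_ceiling_ge)
    finally show ?thesis
      using k X degree_le[OF l hg dim emb \<psi>]
      by (intro weak_coloring_exists[OF hg, of "X * real k / (real k + 1)" \<Delta>])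
         (auto simp: \<Delta>_def \<epsilon>_def n)
  qed
  then have "weak_chi V E \<le> nat \<lceil>X\<rceil>" unfolding weak_chi_def by (rule Least_le)
  moreover have "X \<ge> 0" by (simp add: X_def)
  ultimately have "int (weak_chi V E) \<le> \<lceil>X\<rceil>" by linarith
  then show ?thesis by (simp only: X_def \<epsilon>_def)
qed

theorem mainTheorem15:
  fixes d l n :: nat and V :: "'v set" and E :: "'v set set"
  assumes "3 \<le> l" and "l \<le> d"
    and "uniform_hypergraph d V E" and "card V = n"
    and "DIM('b::euclidean_space) = 2 * d - 1"
    and "DIM('a::euclidean_space) = 2 * d - l"
    and "(\<exists>(\<phi>::'v \<Rightarrow> 'b) (\<psi>::'b \<Rightarrow> 'a). lin_embedding d V E \<phi> \<and> pl_embedding E \<phi> \<psi>)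
         \<or> (\<exists>\<phi>::'v \<Rightarrow> 'a. lin_embedding d V E \<phi>)"
  shows "int (weak_chi V E) \<le>
    \<lceil>(exp 1 * real d) powr (1 / (real d - 1)) *
      real n powr (1 - 3 powr (real l - 1 - real d) / (real d - 1))\<rceil>"
  using assms(7)
proof (elim disjE exE conjE)
  fix \<phi> :: "'v \<Rightarrow> 'b" and \<psi> :: "'b \<Rightarrow> 'a"
  assume emb: "lin_embedding d V E \<phi>" and pl: "pl_embedding E \<phi> \<psi>"
  obtain g where "homeomorphism (hg_image E \<phi>) (\<psi> ` hg_image E \<phi>) \<psi> g"
    using conjunct1[OF pl[unfolded pl_embedding_def]] by (elim exE)
  then have cont: "continuous_on (hg_image E \<phi>) \<psi>"
    and inv: "\<forall>x\<in>hg_image E \<phi>. g (\<psi> x) = x"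
    unfolding homeomorphism_def by simp_all
  have "inj_on \<psi> (hg_image E \<phi>)" using inv by (intro inj_on_inverseI[of _ g]) simp
  with cont show ?thesis by (rule weak_chi_le_of_embedding[OF assms(1-4,6) emb])
next
  fix \<phi> :: "'v \<Rightarrow> 'a"
  assume emb: "lin_embedding d V E \<phi>"
  \<comment> \<open>Here \<open>\<phi>\<close> already maps into the target space, and the identity
    takes the place of \<open>\<psi>\<close>.\<close>
  show ?thesis
    by (rule weak_chi_le_of_embedding[OF assms(1-4,6) emb continuous_on_id inj_on_id2])
qed

end
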